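(* Let $d\in\mathbb N$, $\delta\in(0,1)$, and let $\alpha,\beta\in(0,1)$ satisfy $\alpha+\delta-1>\frac{1-\alpha}{\beta}$. Let $A\in C^\alpha_tC^{1+\beta}_x$ (a field on $\mathbb R^d$). Then for any $x_0\in\mathbb R^d$ there exists a unique solution $x\in C^\gamma_t$ to the fractional YDE $D^\delta_{0+}x_t=A(\mathrm{d} t,x_t)$, i.e. to \[ x=x_0+\Xi\Big[\int_0^\cdot A(\mathrm{d} s,x_s)\Big], \] for any $\gamma$ satisfying $\alpha+\delta-1>\gamma>\frac{1-\alpha}{\beta}$.
   Context: Fix $T>0$. $C^\gamma_t=C^\gamma([0,T];\mathbb R^d)$ with norm $\|f\|_\gamma=\sup|f|+\sup_{s<t}|f_t-f_s|/|t-s|^\gamma$. For $g:\mathbb R^d\to\mathbb R^d$, $\|g\|_\beta=\sup_{x\ne y}|g(x)-g(y)|/|x-y|^\beta+\sup|g|$. A field $A:[0,T]\times\mathbb R^d\to\mathbb R^d$ with $A(0,\cdot)=0$, $A_{s,t}(x)=A(t,x)-A(s,x)$, is in $C^\alpha_tC^{1+\beta}_x$ if $\sup_{s<t}\|A_{s,t}\|_\beta/|t-s|^\alpha<\infty$, $A(t,\cdot)$ is differentiable and $\sup_{s<t}\|\nabla A_{s,t}\|_\beta/|t-s|^\alpha<\infty$. For $x\in C^{\gamma'}_t$ with $\alpha+\beta\gamma'>1$, $\int_0^tA(\mathrm{d} s,x_s)=\lim_{|\Pi|\to0}\sum_iA_{t_i,t_{i+1}}(x_{t_i})$, an element of $C^\alpha_t$.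 The operator $\Xi$: for smooth $f$, $\Xi[f]_t=\int_0^t(t-s)^{\delta-1}\dot f_s\,\mathrm{d} s$; for $\alpha'\in(0,1)$ with $\alpha'+\delta>1$ and any $\varepsilon>0$, $\Xi$ extends uniquely to a continuous linear map $C^{\alpha'}_t\to C^{\alpha'+\delta-1-\varepsilon}_t$, and $\Xi$ denotes this extension. A solution is an $x$ such that $\int_0^\cdot A(\mathrm{d} s,x_s)$ is well defined as a nonlinear Young integral in $C^{\alpha'}_t$ for some $\alpha'>1-\delta$ and $x=x_0+\Xi[\int_0^\cdot A(\mathrm{d} s,x_s)]$. *)

theory Defs
  imports "HOL-Analysis.Analysis"
begin

(* Paths live on [0,T] with values in a Euclidean space 'a (playing the role of R^d). *)

definition holder :: "real \<Rightarrow> real \<Rightarrow> (real \<Rightarrow> 'a::real_normed_vector) \<Rightarrow> bool" where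
  "holder \<gamma> T f \<longleftrightarrow>
     (\<exists>C. \<forall>s\<in>{0..T}. \<forall>t\<in>{0..T}. norm (f t - f s) \<le> C * \<bar>t - s\<bar> powr \<gamma>)"

definition holder_norm :: "real \<Rightarrow> real \<Rightarrow> (real \<Rightarrow> 'a::real_normed_vector) \<Rightarrow> real" where
  "holder_norm \<gamma> T f =
     (SUP t\<in>{0..T}. norm (f t)) +
     (SUP st\<in>{(s,t). 0 \<le> s \<and> s < t \<and> t \<le> T}.
        norm (f (snd st) - f (fst st)) / (snd st - fst st) powr \<gamma>)"

definition field_class :: "real \<Rightarrow> real \<Rightarrow> real \<Rightarrow> (real \<Rightarrow> 'a::euclidean_space \<Rightarrow> 'a) \<Rightarrow> bool" where
  "field_class \<alpha> \<beta> T A \<longleftrightarrow>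
     (\<forall>x. A 0 x = 0) \<and>
     (\<exists>C DA. (\<forall>t\<in>{0..T}. \<forall>x. (A t has_derivative DA t x) (at x)) \<and>
        (\<forall>s t. 0 \<le> s \<and> s < t \<and> t \<le> T \<longrightarrow> (\<forall>x y.
           norm (A t x - A s x) \<le> C * (t - s) powr \<alpha> \<and>
           norm ((A t x - A s x) - (A t y - A s y)) \<le> C * (t - s) powr \<alpha> * norm (x - y) powr \<beta> \<and>
           onorm (\<lambda>v. DA t x v - DA s x v) \<le> C * (t - s) powr \<alpha> \<and>
           onorm (\<lambda>v. (DA t x v - DA s x v) - (DA t y v - DA s y v))
              \<le> C * (t - s) powr \<alpha> * norm (x - y) powr \<beta>)))"

definition young_sum :: "(real \<Rightarrow> 'a \<Rightarrow> 'a::real_normed_vector) \<Rightarrow> (real \<Rightarrow> 'a) \<Rightarrow> (nat \<Rightarrow> real) \<Rightarrow> nat \<Rightarrow> 'a" where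
  "young_sum A x p n = (\<Sum>i<n. A (p (Suc i)) (x (p i)) - A (p i) (x (p i)))"

definition young_lim :: "(real \<Rightarrow> 'a \<Rightarrow> 'a::real_normed_vector) \<Rightarrow> (real \<Rightarrow> 'a) \<Rightarrow> real \<Rightarrow> 'a \<Rightarrow> bool" where
  "young_lim A x t I \<longleftrightarrow>
     (\<forall>\<epsilon>>0. \<exists>\<eta>>0. \<forall>p n. p 0 = 0 \<and> p n = t \<and>
        (\<forall>i<n. p i < p (Suc i) \<and> p (Suc i) - p i < \<eta>) \<longrightarrow>
        norm (young_sum A x p n - I) < \<epsilon>)"

definition young_integral :: "(real \<Rightarrow> 'a \<Rightarrow> 'a::real_normed_vector) \<Rightarrow> (real \<Rightarrow> 'a) \<Rightarrow> real \<Rightarrow> 'a" where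
  "young_integral A x t = (THE I. young_lim A x t I)"

definition smooth_on_int :: "real \<Rightarrow> (real \<Rightarrow> 'a::real_normed_vector) \<Rightarrow> bool" where
  "smooth_on_int T f \<longleftrightarrow>
     (\<exists>fd. fd 0 = f \<and>
        (\<forall>k. \<forall>s\<in>{0..T}. (fd k has_vector_derivative fd (Suc k) s) (at s within {0..T})))"

definition Xi_smooth :: "real \<Rightarrow> real \<Rightarrow> (real \<Rightarrow> 'a::euclidean_space) \<Rightarrow> real \<Rightarrow> 'a" where
  "Xi_smooth \<delta> T f t =
     integral {0..t} (\<lambda>s. (t - s) powr (\<delta> - 1) *\<^sub>R vector_derivative f (at s within {0..T}))"

(* The continuous extension of Xi: value on f is the limit of Xi on smooth
   approximations of f in a Hoelder norm of exponent alpha'' in (1-delta,1). *)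
definition Xi :: "real \<Rightarrow> real \<Rightarrow> (real \<Rightarrow> 'a::euclidean_space) \<Rightarrow> real \<Rightarrow> 'a" where
  "Xi \<delta> T f = (THE g. (\<forall>t. t \<notin> {0..T} \<longrightarrow> g t = 0) \<and>
     (\<forall>\<alpha>''. 1 - \<delta> < \<alpha>'' \<and> \<alpha>'' < 1 \<and> holder \<alpha>'' T f \<longrightarrow>
        (\<forall>fs. (\<forall>n. smooth_on_int T (fs n)) \<and>
              (\<lambda>n. holder_norm \<alpha>'' T (\<lambda>t. fs n t - f t)) \<longlonglongrightarrow> 0 \<longrightarrow>
              (\<forall>t\<in>{0..T}. (\<lambda>n. Xi_smooth \<delta> T (fs n) t) \<longlonglongrightarrow> g t))))"

definition is_solution :: "real \<Rightarrow> real \<Rightarrow> (real \<Rightarrow> 'a::euclidean_space \<Rightarrow> 'a) \<Rightarrow> 'a \<Rightarrow> (real \<Rightarrow> 'a) \<Rightarrow> bool" where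
  "is_solution \<delta> T A x0 x \<longleftrightarrow>
     (\<forall>t\<in>{0..T}. \<exists>I. young_lim A x t I) \<and>
     (\<exists>\<alpha>'. \<alpha>' > 1 - \<delta> \<and> holder \<alpha>' T (young_integral A x)) \<and>
     (\<forall>t\<in>{0..T}. x t = x0 + Xi \<delta> T (young_integral A x) t)"

end

theory Submission
  imports Defs
begin

text \<open>
  Integrating by parts removes the derivative from \<open>\<Xi>\<close> and leaves the Marchaud form
  \<open>(1 - \<delta>) * \<integral> u powr (\<delta> - 2) * (f t - f (t - u)) du\<close>, with \<open>f\<close> continued by \<open>f 0\<close> to the
  left of \<open>0\<close>. This makes sense for every Hoelder path of exponent \<open>a > 1 - \<delta>\<close>, and it shifts the
  exponent by \<open>\<delta> - 1\<close> without loss (split the integral of an increment at \<open>u = t - s\<close>). Together with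
  the sewing lemma for the nonlinear Young integral, the equation becomes
  a fixed point problem in the space of \<open>\<gamma>\<close>-Hoelder paths. Since \<open>A\<close> is bounded and \<open>\<beta> < 1\<close>, the map grows
  sublinearly in the Hoelder seminorm, so a large ball is invariant on all of \<open>[0, T]\<close>. The second
  order (four point) estimate for \<open>A\<close> bounds differences linearly, and since \<open>\<gamma> + 1 - \<delta> < \<alpha>\<close> an
  exponential weight in time turns this into a contraction in spite of the memory of \<open>\<Xi>\<close>. Iteration
  gives existence, and the same contraction on a larger ball gives uniqueness.
\<close>

section \<open>Hoelder bounds on an interval\<close>

text \<open>The two bounds on \<gamma> do separate work. The lower one says \<alpha> + \<beta> *
  \<gamma> > 1: the germ A_{s,t}(x_s) fails to be additive by about (t - s)^\<alpha> times the
  \<beta>-th power of a \<gamma>-Hoelder increment, and sewing needs a total exponent above 1. The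
  upper one keeps the exponent that \<Xi> carries to \<gamma> below \<alpha>. The difference
  estimate has a constant that depends on the Hoelder constant of the paths, so the ball is fixed
  before the weight is chosen. Solutions on short intervals cannot simply be concatenated, since
  \<Xi> at time t sees the whole past.

  The other obstacle is the definite description in \<open>Xi\<close>: it determines a value only if
  smooth approximations exist, and a rough path is in general no limit of smooth paths in its own
  Hoelder norm. Approximation therefore takes place at an exponent strictly between 1 - \<delta> and
  that of the path, and the Marchaud form, which mentions no exponent, supplies one value for all of
  them.\<close>

definition holder_bound :: "real \<Rightarrow> real \<Rightarrow> real \<Rightarrow> (real \<Rightarrow> 'a::real_normed_vector) \<Rightarrow> bool" where
  "holder_bound H a T f \<longleftrightarrow>
     0 \<le> H \<and> (\<forall>s t. 0 \<le> s \<and> s \<le> t \<and> t \<le> T \<longrightarrow> norm (f t - f s) \<le> H * (t - s) powr a)"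

lemma holder_boundI:
  assumes "0 \<le> H" "\<And>s t. 0 \<le> s \<Longrightarrow> s \<le> t \<Longrightarrow> t \<le> T \<Longrightarrow> norm (f t - f s) \<le> H * (t - s) powr a"
  shows "holder_bound H a T f"
  using assms unfolding holder_bound_def by auto

lemma holder_boundD:
  assumes "holder_bound H a T f" "0 \<le> s" "s \<le> t" "t \<le> T"
  shows "norm (f t - f s) \<le> H * (t - s) powr a"
  using assms unfolding holder_bound_def by auto

lemma holder_bound_nonneg: "holder_bound H a T f \<Longrightarrow> 0 \<le> H"
  unfolding holder_bound_def by auto

lemma holder_bound_abs:
  assumes "holder_bound H a T f" "s \<in> {0..T}" "t \<in> {0..T}"
  shows "norm (f t - f s) \<le> H * \<bar>t - s\<bar> powr a"
proof (cases "s \<le> t")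
  case True
  then show ?thesis using holder_boundD[OF assms(1), of s t] assms by auto
next
  case False
  then show ?thesis using holder_boundD[OF assms(1), of t s] assms by (auto simp: norm_minus_commute)
qed

lemma holder_iff_holder_bound: "holder a T f \<longleftrightarrow> (\<exists>H. holder_bound H a T f)"
proof
  assume "holder a T f"
  then obtain C where C: "\<forall>s\<in>{0..T}. \<forall>t\<in>{0..T}. norm (f t - f s) \<le> C * \<bar>t - s\<bar> powr a"
    unfolding holder_def by auto
  have "holder_bound \<bar>C\<bar> a T f"
  proof (rule holder_boundI)
    fix s t assume st: "0 \<le> s" "s \<le> t" "t \<le> T"
    have "norm (f t - f s) \<le> C * \<bar>t - s\<bar> powr a" using C st by (meson atLeastAtMost_iff order_trans)
    also have "\<dots> \<le> \<bar>C\<bar> * (t - s) powr a" using st by (auto intro!: mult_right_mono)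
    finally show "norm (f t - f s) \<le> \<bar>C\<bar> * (t - s) powr a" .
  qed auto
  then show "\<exists>H. holder_bound H a T f" by auto
next
  assume "\<exists>H. holder_bound H a T f"
  then show "holder a T f" unfolding holder_def using holder_bound_abs by blast
qed

lemma holder_bound_continuous_on:
  assumes "holder_bound H a T f" "0 < a"
  shows "continuous_on {0..T} f"
  unfolding continuous_on_def
proof
  fix s assume s: "s \<in> {0..T}"
  have "((\<lambda>t. H * \<bar>t - s\<bar> powr a) \<longlongrightarrow> H * \<bar>s - s\<bar> powr a) (at s within {0..T})"
    using assms(2) by (intro tendsto_intros) auto
  then have "((\<lambda>t. H * \<bar>t - s\<bar> powr a) \<longlongrightarrow> 0) (at s within {0..T})" by simp
  moreover have "\<forall>\<^sub>F t in at s within {0..T}. norm (f t - f s) \<le> H * \<bar>t - s\<bar> powr a"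
    using holder_bound_abs[OF assms(1) s] by (auto simp: eventually_at_filter)
  ultimately have "((\<lambda>t. f t - f s) \<longlongrightarrow> 0) (at s within {0..T})"
    by (rule Lim_null_comparison[rotated])
  then show "(f \<longlongrightarrow> f s) (at s within {0..T})" by (simp add: LIM_zero_iff)
qed

lemma holder_bound_weaken:
  assumes "holder_bound H b T f" "a \<le> b" "0 < T"
  shows "holder_bound (H * T powr (b - a)) a T f"
proof (rule holder_boundI)
  show "0 \<le> H * T powr (b - a)" using holder_bound_nonneg[OF assms(1)] by simp
  fix s t assume st: "0 \<le> s" "s \<le> t" "t \<le> T"
  have "norm (f t - f s) \<le> H * (t - s) powr b" by (rule holder_boundD[OF assms(1) st])
  also have "(t - s) powr b = (t - s) powr (b - a) * (t - s) powr a"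
    by (simp add: powr_add[symmetric])
  also have "H * \<dots> \<le> H * (T powr (b - a) * (t - s) powr a)"
    using holder_bound_nonneg[OF assms(1)] st assms
    by (intro mult_left_mono mult_right_mono powr_mono2) auto
  finally show "norm (f t - f s) \<le> H * T powr (b - a) * (t - s) powr a" by simp
qed

lemma holder_bound_mono:
  assumes "holder_bound H a T f" "H \<le> H'" "T' \<le> T"
  shows "holder_bound H' a T' f"
proof (rule holder_boundI)
  show "0 \<le> H'" using holder_bound_nonneg[OF assms(1)] assms by simp
  fix s t assume st: "0 \<le> s" "s \<le> t" "t \<le> T'"
  have "norm (f t - f s) \<le> H * (t - s) powr a" by (rule holder_boundD[OF assms(1)]) (use st assms in auto)
  also have "\<dots> \<le> H' * (t - s) powr a" using assms by (intro mult_right_mono) auto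
  finally show "norm (f t - f s) \<le> H' * (t - s) powr a" .
qed

lemma holder_bound_diff:
  assumes f: "holder_bound H a T f" and g: "holder_bound K a T g"
  shows "holder_bound (H + K) a T (\<lambda>t. f t - g t)"
proof (rule holder_boundI)
  show "0 \<le> H + K" using holder_bound_nonneg[OF f] holder_bound_nonneg[OF g] by simp
  fix s t assume st: "0 \<le> s" "s \<le> t" "t \<le> T"
  have "norm ((f t - f s) - (g t - g s)) \<le> H * (t - s) powr a + K * (t - s) powr a"
    using norm_triangle_ineq4[of "f t - f s" "g t - g s"] holder_boundD[OF f st] holder_boundD[OF g st]
    by linarith
  then show "norm ((f t - g t) - (f s - g s)) \<le> (H + K) * (t - s) powr a"
    by (simp add: algebra_simps)
qed

section \<open>The Marchaud form of the fractional operator\<close>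

lemma has_integral_truncated_powr:
  fixes a b B k :: real
  assumes "0 < k" "b < -1" "a + b > -1"
  shows "((\<lambda>u. B * (if u \<le> k then u powr (a + b) else k powr a * u powr b)) has_integral
           (B * k powr (a + b + 1) * (1 / (a + b + 1) + 1 / (- b - 1)))) {0..}"
proof -
  let ?g = "\<lambda>u. B * (if u \<le> k then u powr (a + b) else k powr a * u powr b)"
  have "((\<lambda>u. B * u powr (a + b)) has_integral (B * (k powr (a + b + 1) / (a + b + 1)))) {0..k}"
    by (intro has_integral_mult_right has_integral_powr_from_0) (use assms in auto)
  then have 1: "(?g has_integral (B * (k powr (a + b + 1) / (a + b + 1)))) {0..k}"
    by (rule has_integral_eq[rotated]) auto
  have "((\<lambda>u. (B * k powr a) * u powr b) has_integral (B * k powr a * - (k powr (b + 1) / (b + 1)))) {k..}"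
    using has_integral_powr_to_inf[of b k] assms by (intro has_integral_mult_right) auto
  then have 2: "(?g has_integral (B * k powr a * - (k powr (b + 1) / (b + 1)))) {k..}"
    by (rule has_integral_eq[rotated]) (auto simp: powr_add)
  have "(?g has_integral (B * (k powr (a + b + 1) / (a + b + 1)) + B * k powr a * - (k powr (b + 1) / (b + 1)))) ({0..k} \<union> {k..})"
  proof (rule has_integral_Un[OF 1 2])
    have "{0..k} \<inter> {k..} \<subseteq> {k}" by auto
    then show "negligible ({0..k} \<inter> {k..})" using negligible_subset negligible_sing by blast
  qed
  moreover have "{0..k} \<union> {k..} = {0..}" using assms by auto
  moreover have *: "k powr a * k powr (b + 1) = k powr (a + b + 1)" by (simp add: powr_add[symmetric] algebra_simps)
  have "B * (k powr (a + b + 1) / (a + b + 1)) + B * k powr a * - (k powr (b + 1) / (b + 1))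
     = B * k powr (a + b + 1) * (1 / (a + b + 1) + 1 / (- b - 1))"
    (is "?l = ?r")
  proof -
    have "- b - 1 = - (b + 1)" by simp
    then have "1 / (- b - 1) = - (1 / (b + 1))" by (simp only: minus_divide_right)
    then have "?r = B * k powr (a + b + 1) * (1 / (a + b + 1) + - (1 / (b + 1)))" by simp
    also have "\<dots> = B * k powr (a + b + 1) / (a + b + 1) - B * (k powr a * k powr (b + 1)) / (b + 1)"
      unfolding * by (simp add: distrib_left right_diff_distrib)
    finally show "?l = ?r" by simp
  qed
  ultimately show ?thesis by simp
qed

text \<open>Near the origin the Hoelder smallness of \<phi> beats the singular kernel; beyond the
  scale k the kernel decays and the bound of \<phi> at scale k is enough. With b = \<delta> - 2 the
  conditions on the exponents read \<delta> < 1 and a + \<delta> > 1. The scale is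
  \<open>t - s\<close> for increments of the operator and \<open>t + 1\<close> when only
  integrability is wanted.\<close>

lemma integral_truncated_powr_bound:
  fixes \<phi> :: "real \<Rightarrow> 'a::euclidean_space"
  assumes k: "0 < k" and b: "b < -1" and ab: "a + b > -1"
    and cont: "continuous_on {0..} \<phi>"
    and small: "\<And>u. 0 \<le> u \<Longrightarrow> u \<le> k \<Longrightarrow> norm (\<phi> u) \<le> B * u powr a"
    and large: "\<And>u. k \<le> u \<Longrightarrow> norm (\<phi> u) \<le> B * k powr a"
  shows "(\<lambda>u. u powr b *\<^sub>R \<phi> u) integrable_on {0..}"
    and "norm (integral {0..} (\<lambda>u. u powr b *\<^sub>R \<phi> u))
           \<le> B * k powr (a + b + 1) * (1 / (a + b + 1) + 1 / (- b - 1))"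
proof -
  let ?g = "\<lambda>u. B * (if u \<le> k then u powr (a + b) else k powr a * u powr b)"
  note g = has_integral_truncated_powr[OF k b ab, of B]
  have le: "norm (u powr b *\<^sub>R \<phi> u) \<le> ?g u" if "u \<in> {0..}" for u
  proof (cases "u \<le> k")
    case True
    have "norm (u powr b *\<^sub>R \<phi> u) \<le> u powr b * (B * u powr a)"
      using small[of u] that True by (auto intro!: mult_left_mono)
    then show ?thesis using True by (simp add: powr_add mult_ac)
  next
    case False
    have "norm (u powr b *\<^sub>R \<phi> u) \<le> u powr b * (B * k powr a)"
      using large[of u] that False by (auto intro!: mult_left_mono)
    then show ?thesis using False by (simp add: mult_ac)
  qed
  show int: "(\<lambda>u. u powr b *\<^sub>R \<phi> u) integrable_on {0..}"
  proof (rule measurable_bounded_by_integrable_imp_integrable[where g = ?g])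
    have "\<phi> \<in> borel_measurable (lebesgue_on {0..})"
      by (intro continuous_imp_measurable_on_sets_lebesgue cont) auto
    moreover have "(\<lambda>u. u powr b) \<in> borel_measurable (lebesgue_on {0::real..})"
      by (rule measurable_restrict_space1) (auto intro!: measurable_completion)
    ultimately show "(\<lambda>u. u powr b *\<^sub>R \<phi> u) \<in> borel_measurable (lebesgue_on {0..})"
      by (rule borel_measurable_scaleR[rotated])
    show "?g integrable_on {0..}" using g by blast
  qed (use le in auto)
  have "norm (integral {0..} (\<lambda>u. u powr b *\<^sub>R \<phi> u)) \<le> integral {0..} ?g"
    by (rule integral_norm_bound_integral[OF int]) (use g le in auto)
  also have "\<dots> = B * k powr (a + b + 1) * (1 / (a + b + 1) + 1 / (- b - 1))"
    using g by (rule integral_unique)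
  finally show "norm (integral {0..} (\<lambda>u. u powr b *\<^sub>R \<phi> u))
           \<le> B * k powr (a + b + 1) * (1 / (a + b + 1) + 1 / (- b - 1))" .
qed

definition marchaud :: "real \<Rightarrow> (real \<Rightarrow> 'a::euclidean_space) \<Rightarrow> real \<Rightarrow> 'a" where
  "marchaud \<delta> f t =
     (1 - \<delta>) *\<^sub>R integral {0..} (\<lambda>u. u powr (\<delta> - 2) *\<^sub>R (f t - f (max 0 (t - u))))"

lemma continuous_on_backward_increment:
  fixes f :: "real \<Rightarrow> 'a::real_normed_vector"
  assumes "continuous_on {0..t} f" "0 \<le> t"
  shows "continuous_on {0..} (\<lambda>u. f t - f (max 0 (t - u)))"
  by (intro continuous_intros continuous_on_compose2[OF assms(1)]) (use assms in auto)

lemma marchaud_integrable: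
  fixes f :: "real \<Rightarrow> 'a::euclidean_space"
  assumes f: "holder_bound H a t f" and t: "0 \<le> t" and \<delta>: "0 < \<delta>" "\<delta> < 1" and a: "a + \<delta> > 1"
  shows "(\<lambda>u. u powr (\<delta> - 2) *\<^sub>R (f t - f (max 0 (t - u)))) integrable_on {0..}"
proof (rule integral_truncated_powr_bound(1)[where k = "t + 1" and a = a and B = H])
  note H = holder_bound_nonneg[OF f]
  have 1: "norm (f t - f (max 0 (t - u))) \<le> H * (min u t) powr a" if "0 \<le> u" for u
  proof -
    have "norm (f t - f (max 0 (t - u))) \<le> H * (t - max 0 (t - u)) powr a"
      by (rule holder_boundD[OF f]) (use that t in auto)
    also have "t - max 0 (t - u) = min u t" by auto
    finally show ?thesis .
  qed
  show "norm (f t - f (max 0 (t - u))) \<le> H * u powr a" if "0 \<le> u" for u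
    using that t a \<delta> H
    by (intro order_trans[OF 1[OF that]] mult_left_mono powr_mono2) auto
  show "norm (f t - f (max 0 (t - u))) \<le> H * (t + 1) powr a" if "t + 1 \<le> u" for u
    using that t a \<delta> H
    by (intro order_trans[OF 1[of u]] mult_left_mono powr_mono2) auto
  show "continuous_on {0..} (\<lambda>u. f t - f (max 0 (t - u)))"
    using holder_bound_continuous_on[OF f] a \<delta> t by (intro continuous_on_backward_increment) auto
qed (use t \<delta> a in auto)

lemma marchaud_diff:
  fixes f g :: "real \<Rightarrow> 'a::euclidean_space"
  assumes "holder_bound H a t f" "holder_bound K a t g" "0 \<le> t" "0 < \<delta>" "\<delta> < 1" "a + \<delta> > 1"
  shows "marchaud \<delta> (\<lambda>s. f s - g s) t = marchaud \<delta> f t - marchaud \<delta> g t"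
proof -
  have "integral {0..} (\<lambda>u. u powr (\<delta> - 2) *\<^sub>R (f t - f (max 0 (t - u))))
        - integral {0..} (\<lambda>u. u powr (\<delta> - 2) *\<^sub>R (g t - g (max 0 (t - u))))
       = integral {0..} (\<lambda>u. u powr (\<delta> - 2) *\<^sub>R (f t - f (max 0 (t - u))) - u powr (\<delta> - 2) *\<^sub>R (g t - g (max 0 (t - u))))"
    by (rule integral_diff[symmetric]) (use assms in \<open>auto intro: marchaud_integrable\<close>)
  then show ?thesis unfolding marchaud_def scaleR_right_diff_distrib[symmetric]
    by (simp add: algebra_simps)
qed

lemma marchaud_0:
  fixes f :: "real \<Rightarrow> 'a::euclidean_space"
  shows "marchaud \<delta> f 0 = 0"
proof -
  have "integral {0..} (\<lambda>u. u powr (\<delta> - 2) *\<^sub>R (f 0 - f (max 0 (0 - u)))) = integral {0..} (\<lambda>u::real. 0::'a)"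
    by (rule integral_cong) auto
  then show ?thesis unfolding marchaud_def by simp
qed

definition marchaud_const :: "real \<Rightarrow> real \<Rightarrow> real" where
  "marchaud_const \<delta> a = 2 * (1 - \<delta>) * (1 / (a + \<delta> - 1) + 1 / (1 - \<delta>))"

lemma marchaud_const_pos:
  assumes "\<delta> < 1" "a + \<delta> > 1"
  shows "0 < marchaud_const \<delta> a"
  unfolding marchaud_const_def using assms by (intro mult_pos_pos add_pos_pos) auto

text \<open>The increment of the integrand has two readings. As a difference of two backward
  increments over u it is of order u powr a; regrouped as the increment over [s, t] minus the same
  increment moved back by u, it is of order (t - s) powr a. Each is used on its own side of u = t -
  s, where the two bounds coincide. The 2 in \<open>marchaud_const\<close> counts the two terms in
  either reading.\<close>

lemma marchaud_holder_bound:
  fixes f :: "real \<Rightarrow> 'a::euclidean_space"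
  assumes f: "holder_bound H a T f" and \<delta>: "0 < \<delta>" "\<delta> < 1" and a: "a + \<delta> > 1"
  shows "holder_bound (marchaud_const \<delta> a * H) (a + \<delta> - 1) T (marchaud \<delta> f)"
proof (rule holder_boundI)
  note H = holder_bound_nonneg[OF f]
  show "0 \<le> marchaud_const \<delta> a * H" using marchaud_const_pos[OF \<delta>(2) a] H by simp
  fix s t assume st: "0 \<le> s" "s \<le> t" "t \<le> T"
  show "norm (marchaud \<delta> f t - marchaud \<delta> f s) \<le> marchaud_const \<delta> a * H * (t - s) powr (a + \<delta> - 1)"
  proof (cases "s = t")
    case False
    define k where "k = t - s"
    have k: "0 < k" using False st by (auto simp: k_def)
    have ft: "holder_bound H a t f" and fs: "holder_bound H a s f"
      using holder_bound_mono[OF f] st by auto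
    let ?\<phi> = "\<lambda>t u. f t - f (max 0 (t - u))"
    have inc: "norm (?\<phi> r u) \<le> H * u powr a" if "0 \<le> r" "r \<le> t" "0 \<le> u" for r u
    proof -
      have "norm (?\<phi> r u) \<le> H * (r - max 0 (r - u)) powr a"
        by (rule holder_boundD[OF ft]) (use that in auto)
      also have "\<dots> \<le> H * u powr a" using that a \<delta> H by (intro mult_left_mono powr_mono2) auto
      finally show ?thesis .
    qed
    have 1: "norm (?\<phi> t u - ?\<phi> s u) \<le> 2 * H * u powr a" if "0 \<le> u" for u
      using norm_triangle_ineq4[of "?\<phi> t u" "?\<phi> s u"] inc[of t u] inc[of s u] that st by auto
    have 2: "norm (?\<phi> t u - ?\<phi> s u) \<le> 2 * H * k powr a" if "0 \<le> u" for u
    proof -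
      have "norm (f (max 0 (t - u)) - f (max 0 (s - u))) \<le> H * (max 0 (t - u) - max 0 (s - u)) powr a"
        by (rule holder_boundD[OF ft]) (use that st in auto)
      also have "\<dots> \<le> H * k powr a"
        using st a \<delta> H by (intro mult_left_mono powr_mono2) (auto simp: k_def)
      finally have "norm (f (max 0 (t - u)) - f (max 0 (s - u))) \<le> H * k powr a" .
      moreover have "norm (f t - f s) \<le> H * k powr a"
        unfolding k_def by (rule holder_boundD[OF ft]) (use st in auto)
      moreover have "norm (?\<phi> t u - ?\<phi> s u) = norm ((f t - f s) - (f (max 0 (t - u)) - f (max 0 (s - u))))"
        by (simp add: algebra_simps)
      ultimately show ?thesis
        using norm_triangle_ineq4[of "f t - f s" "f (max 0 (t - u)) - f (max 0 (s - u))"] by linarith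
    qed
    have "norm (integral {0..} (\<lambda>u. u powr (\<delta> - 2) *\<^sub>R (?\<phi> t u - ?\<phi> s u)))
        \<le> 2 * H * k powr (a + (\<delta> - 2) + 1) * (1 / (a + (\<delta> - 2) + 1) + 1 / (- (\<delta> - 2) - 1))"
    proof (rule integral_truncated_powr_bound(2)[OF k])
      show "continuous_on {0..} (\<lambda>u. ?\<phi> t u - ?\<phi> s u)"
        using holder_bound_continuous_on[OF ft] holder_bound_continuous_on[OF fs] a \<delta> st
        by (intro continuous_on_diff continuous_on_backward_increment) auto
    qed (use \<delta> a 1 2 k in auto)
    also have "\<dots> = 2 * H * k powr (a + \<delta> - 1) * (1 / (a + \<delta> - 1) + 1 / (1 - \<delta>))" 
      by (simp add: algebra_simps)
    finally have 3: "norm (integral {0..} (\<lambda>u. u powr (\<delta> - 2) *\<^sub>R (?\<phi> t u - ?\<phi> s u)))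
       \<le> 2 * H * k powr (a + \<delta> - 1) * (1 / (a + \<delta> - 1) + 1 / (1 - \<delta>))" .
    have "integral {0..} (\<lambda>u. u powr (\<delta> - 2) *\<^sub>R ?\<phi> t u) - integral {0..} (\<lambda>u. u powr (\<delta> - 2) *\<^sub>R ?\<phi> s u)
      = integral {0..} (\<lambda>u. u powr (\<delta> - 2) *\<^sub>R ?\<phi> t u - u powr (\<delta> - 2) *\<^sub>R ?\<phi> s u)"
      by (rule integral_diff[symmetric])
         (use marchaud_integrable[OF ft] marchaud_integrable[OF fs] \<delta> a st in auto)
    then have "marchaud \<delta> f t - marchaud \<delta> f s = (1 - \<delta>) *\<^sub>R integral {0..} (\<lambda>u. u powr (\<delta> - 2) *\<^sub>R (?\<phi> t u - ?\<phi> s u))"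
      unfolding marchaud_def by (simp add: scaleR_right_diff_distrib[symmetric])
    then have "norm (marchaud \<delta> f t - marchaud \<delta> f s)
       \<le> (1 - \<delta>) * (2 * H * k powr (a + \<delta> - 1) * (1 / (a + \<delta> - 1) + 1 / (1 - \<delta>)))"
      using 3 \<delta> by (auto intro!: mult_left_mono)
    then show ?thesis unfolding marchaud_const_def k_def by (simp only: mult_ac)
  qed simp
qed

section \<open>Smooth paths: agreement of \<Xi> with its Marchaud form\<close>

lemma smooth_on_int_antiderivative:
  fixes p :: "real \<Rightarrow> 'a::euclidean_space"
  assumes "polynomial_function p"
  shows "smooth_on_int T (\<lambda>t. c + integral {0..t} p)"
proof -
  \<comment> \<open>Smoothness asks for one sequence of all derivatives; a choice of derivative for
    every polynomial function gives an operator that can be iterated.\<close>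
  define D :: "(real \<Rightarrow> 'a) \<Rightarrow> real \<Rightarrow> 'a" where
    "D q = (SOME q'. polynomial_function q' \<and> (\<forall>x. (q has_vector_derivative q' x) (at x)))" for q
  have D: "polynomial_function (D q) \<and> (\<forall>x. (q has_vector_derivative D q x) (at x))"
    if q: "polynomial_function q" for q
  proof -
    obtain q' where "polynomial_function q'" "\<And>x. (q has_vector_derivative q' x) (at x)"
      by (rule has_vector_derivative_polynomial_function[OF q]) (rule that)
    then have "\<exists>q'. polynomial_function q' \<and> (\<forall>x. (q has_vector_derivative q' x) (at x))" by auto
    then show ?thesis unfolding D_def by (rule someI_ex)
  qed
  have poly: "polynomial_function ((D ^^ k) p)" for k
    by (induction k) (use assms D in auto)
  define fd where "fd k = (case k of 0 \<Rightarrow> (\<lambda>t. c + integral {0..t} p) | Suc j \<Rightarrow> (D ^^ j) p)" for k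
  have "(fd k has_vector_derivative fd (Suc k) s) (at s within {0..T})" if "s \<in> {0..T}" for k s
  proof (cases k)
    case 0
    have "((\<lambda>t. c + integral {0..t} p) has_vector_derivative (0 + p s)) (at s within {0..T})"
      by (intro has_vector_derivative_add has_vector_derivative_const integral_has_vector_derivative
          continuous_on_polymonial_function assms that)
    then show ?thesis by (simp add: 0 fd_def)
  next
    case (Suc j)
    then show ?thesis using D[OF poly[of j]] by (auto simp: fd_def intro: has_vector_derivative_at_within)
  qed
  moreover have "fd 0 = (\<lambda>t. c + integral {0..t} p)" by (simp add: fd_def)
  ultimately show ?thesis unfolding smooth_on_int_def by blast
qed

lemma smooth_on_int_derivative:
  assumes "smooth_on_int T f"
  obtains f' where "continuous_on {0..T} f'"
    "\<And>s. s \<in> {0..T} \<Longrightarrow> (f has_vector_derivative f' s) (at s within {0..T})"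
proof -
  obtain fd where fd: "fd 0 = f"
    "\<And>k s. s \<in> {0..T} \<Longrightarrow> (fd k has_vector_derivative fd (Suc k) s) (at s within {0..T})"
    using assms unfolding smooth_on_int_def by auto
  have "continuous_on {0..T} (fd 1)"
    using fd(2)[of _ 1] has_vector_derivative_continuous continuous_on_eq_continuous_within by blast
  then show thesis using that[of "fd 1"] fd(1) fd(2)[of _ 0] by auto
qed

lemma holder_bound_of_derivative:
  fixes f :: "real \<Rightarrow> 'a::euclidean_space"
  assumes f': "continuous_on {0..T} f'"
    "\<And>s. s \<in> {0..T} \<Longrightarrow> (f has_vector_derivative f' s) (at s within {0..T})"
  obtains L where "holder_bound L 1 T f"
proof -
  have "bounded (f' ` {0..T})" using f'(1) by (intro compact_imp_bounded compact_continuous_image) auto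
  then obtain L where L: "0 < L" "\<And>s. s \<in> {0..T} \<Longrightarrow> norm (f' s) \<le> L"
    unfolding bounded_pos by auto
  have "holder_bound L 1 T f"
  proof (rule holder_boundI)
    fix s t assume st: "0 \<le> s" "s \<le> t" "t \<le> T"
    have "(f' has_integral (f t - f s)) {s..t}"
      by (rule fundamental_theorem_of_calculus)
         (use st in \<open>auto intro: has_vector_derivative_within_subset[OF f'(2)]\<close>)
    then have "f t - f s = integral {s..t} f'" by (rule integral_unique[symmetric])
    also have "norm \<dots> \<le> L * (t - s)"
      by (rule integral_bound) (use st L in \<open>auto intro: continuous_on_subset[OF f'(1)]\<close>)
    finally show "norm (f t - f s) \<le> L * (t - s) powr 1" using st by simp
  qed (use L in auto)
  then show thesis by (rule that)
qed

text \<open>Past u = t the increment is frozen at \<open>f t - f 0\<close>, and the tail of the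
  kernel integrates to t powr (\<delta> - 1) / (1 - \<delta>). The term extracted in this way is the
  boundary term at u = t of the integration by parts that follows.\<close>

lemma marchaud_lipschitz_split:
  fixes f :: "real \<Rightarrow> 'a::euclidean_space"
  assumes t: "0 < t" and \<delta>: "0 < \<delta>" "\<delta> < 1" and f: "holder_bound L 1 t f"
  shows "(\<lambda>u. u powr (\<delta> - 2) *\<^sub>R (f t - f (t - u))) integrable_on {0..t}" (is "?\<phi> integrable_on _")
    and "marchaud \<delta> f t = (1 - \<delta>) *\<^sub>R integral {0..t} (\<lambda>u. u powr (\<delta> - 2) *\<^sub>R (f t - f (t - u)))
           + t powr (\<delta> - 1) *\<^sub>R (f t - f 0)"
proof -
  let ?\<psi> = "\<lambda>u. u powr (\<delta> - 2) *\<^sub>R (f t - f (max 0 (t - u)))"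
  have "?\<psi> integrable_on {0..}"
    by (rule marchaud_integrable[OF f]) (use t \<delta> in auto)
  then have "?\<psi> integrable_on {0..t}"
    by (rule integrable_on_subinterval) auto
  then show int: "?\<phi> integrable_on {0..t}"
    by (rule integrable_eq) auto
  then have 1: "(?\<psi> has_integral integral {0..t} ?\<phi>) {0..t}"
    by (intro has_integral_eq[OF _ integrable_integral[OF int]]) auto
  have "((\<lambda>u. u powr (\<delta> - 2)) has_integral - (t powr (\<delta> - 2 + 1)) / (\<delta> - 2 + 1)) {t..}"
    by (rule has_integral_powr_to_inf) (use t \<delta> in auto)
  then have "((\<lambda>u. u powr (\<delta> - 2) *\<^sub>R (f t - f 0)) has_integral
      (- (t powr (\<delta> - 2 + 1)) / (\<delta> - 2 + 1)) *\<^sub>R (f t - f 0)) {t..}"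
    by (rule has_integral_scaleR_left)
  then have 2: "(?\<psi> has_integral (- (t powr (\<delta> - 2 + 1)) / (\<delta> - 2 + 1)) *\<^sub>R (f t - f 0)) {t..}"
    by (rule has_integral_eq[rotated]) auto
  have "(?\<psi> has_integral integral {0..t} ?\<phi> + (- (t powr (\<delta> - 2 + 1)) / (\<delta> - 2 + 1)) *\<^sub>R (f t - f 0)) ({0..t} \<union> {t..})"
  proof (rule has_integral_Un[OF 1 2])
    have "{0..t} \<inter> {t..} \<subseteq> {t}" by auto
    then show "negligible ({0..t} \<inter> {t..})" using negligible_subset negligible_sing by blast
  qed
  moreover have "{0..t} \<union> {t..} = {0..}" using t by auto
  ultimately have "integral {0..} ?\<psi> = integral {0..t} ?\<phi> + (- (t powr (\<delta> - 2 + 1)) / (\<delta> - 2 + 1)) *\<^sub>R (f t - f 0)"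
    by (simp add: integral_unique)
  moreover have "\<delta> - 2 + 1 = - (1 - \<delta>)" by simp
  then have "(1 - \<delta>) * (- (t powr (\<delta> - 2 + 1)) / (\<delta> - 2 + 1)) = t powr (\<delta> - 1)"
    using \<delta> by (simp add: field_simps)
  ultimately show "marchaud \<delta> f t = (1 - \<delta>) *\<^sub>R integral {0..t} ?\<phi> + t powr (\<delta> - 1) *\<^sub>R (f t - f 0)"
    unfolding marchaud_def by (simp only: scaleR_right_distrib scaleR_scaleR)
qed

text \<open>Integration by parts after the reflection s = t - u. The singular integrand of \<Xi>
  gets its integrability from being the difference of the Marchaud integrand and an exact
  derivative.\<close>

lemma Xi_smooth_eq_marchaud:
  fixes f :: "real \<Rightarrow> 'a::euclidean_space"
  assumes f: "smooth_on_int T f" and \<delta>: "0 < \<delta>" "\<delta> < 1" and T: "0 < T" and t: "t \<in> {0..T}"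
  shows "Xi_smooth \<delta> T f t = marchaud \<delta> f t"
proof (cases "t = 0")
  case True
  then show ?thesis by (simp add: Xi_smooth_def marchaud_0)
next
  case False
  then have t0: "0 < t" using t by auto
  obtain f' where cf': "continuous_on {0..T} f'"
    and f': "\<And>s. s \<in> {0..T} \<Longrightarrow> (f has_vector_derivative f' s) (at s within {0..T})"
    using smooth_on_int_derivative[OF f] by blast
  obtain L where L: "holder_bound L 1 T f" using holder_bound_of_derivative[OF cf' f'] by blast
  then have Lt: "holder_bound L 1 t f" using t by (auto intro: holder_bound_mono)
  note split = marchaud_lipschitz_split[OF t0 \<delta> Lt]
  let ?\<phi> = "\<lambda>u. u powr (\<delta> - 2) *\<^sub>R (f t - f (t - u))"
  \<comment> \<open>The primitive of the integration by parts. Subtracting \<open>f t\<close> makes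
    it continuous at 0, where the Lipschitz bound of f gives norm (F u) at most L * u powr \<delta>.
    Its value at t is minus the boundary term in \<open>split(2)\<close>.\<close>
  define F where "F u = u powr (\<delta> - 1) *\<^sub>R (f (t - u) - f t)" for u
  have cf: "continuous_on {0..T} f" using L holder_bound_continuous_on by fastforce
  have cF: "continuous_on {0..t} F"
    unfolding continuous_on_eq_continuous_within
  proof
    fix u assume u: "u \<in> {0..t}"
    show "continuous (at u within {0..t}) F"
    proof (cases "u = 0")
      case True
      have "((\<lambda>v. L * v powr \<delta>) \<longlongrightarrow> L * 0 powr \<delta>) (at 0 within {0..t})"
        using \<delta> by (intro tendsto_intros) (auto simp: eventually_at_filter)
      then have lim: "((\<lambda>v. L * v powr \<delta>) \<longlongrightarrow> 0) (at 0 within {0..t})" by simp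
      have "norm (F v) \<le> L * v powr \<delta>" if "v \<in> {0..t}" "v \<noteq> 0" for v
      proof -
        have "norm (f t - f (t - v)) \<le> L * (t - (t - v)) powr 1"
          by (rule holder_boundD[OF Lt]) (use that in auto)
        then have "norm (F v) \<le> v powr (\<delta> - 1) * (L * v powr 1)"
          using that unfolding F_def by (auto simp: norm_minus_commute intro!: mult_left_mono)
        also have "\<dots> = L * v powr (\<delta> - 1 + 1)" by (simp only: powr_add mult_ac)
        finally show ?thesis by simp
      qed
      then have "(F \<longlongrightarrow> 0) (at 0 within {0..t})"
        by (intro Lim_null_comparison[OF _ lim]) (auto simp: eventually_at_filter)
      then show ?thesis by (simp add: continuous_within True F_def)
    next
      case False
      have "continuous_on {u/2..t} F"
        unfolding F_def
        by (intro continuous_intros continuous_on_compose2[OF cf]) (use t u False in auto)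
      then have "continuous (at u within {u/2..t}) F"
        using u False by (auto simp: continuous_on_eq_continuous_within)
      moreover have "at u within {u/2..t} = at u within {0..t}"
        by (rule at_within_nhd[where S = "{u/2<..}"]) (use u False in auto)
      ultimately show ?thesis by simp
    qed
  qed
  have "((\<lambda>u. (1 - \<delta>) *\<^sub>R ?\<phi> u - u powr (\<delta> - 1) *\<^sub>R f' (t - u)) has_integral (F t - F 0)) {0..t}"
  proof (rule fundamental_theorem_of_calculus_interior[OF _ cF])
    fix u assume u: "u \<in> {0<..<t}"
    have "(f has_vector_derivative f' (t - u)) (at (t - u) within {0..T})"
      by (rule f') (use u t in auto)
    then have "(f has_vector_derivative f' (t - u)) (at (t - u))"
      using u t by (subst (asm) at_within_interior) auto
    moreover have "((\<lambda>u. t - u) has_vector_derivative (0 - 1)) (at u)"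
      by (intro has_vector_derivative_diff has_vector_derivative_const has_vector_derivative_id)
    ultimately have "((f \<circ> (\<lambda>u. t - u)) has_vector_derivative ((0 - 1) *\<^sub>R f' (t - u))) (at u)"
      by (intro vector_diff_chain_at)
    then have 1: "((\<lambda>u. f (t - u) - f t) has_vector_derivative (- f' (t - u) - 0)) (at u)"
      by (intro has_vector_derivative_diff has_vector_derivative_const) (simp add: o_def)
    have 2: "((\<lambda>u. u powr (\<delta> - 1)) has_field_derivative ((\<delta> - 1) * u powr (\<delta> - 2))) (at u)"
      using u by (auto intro!: derivative_eq_intros)
    have "(F has_vector_derivative
        (u powr (\<delta> - 1) *\<^sub>R (- f' (t - u) - 0) + ((\<delta> - 1) * u powr (\<delta> - 2)) *\<^sub>R (f (t - u) - f t))) (at u)"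
      unfolding F_def by (rule has_vector_derivative_scaleR[OF 2 1])
    moreover have "u powr (\<delta> - 1) *\<^sub>R (- f' (t - u) - 0) + ((\<delta> - 1) * u powr (\<delta> - 2)) *\<^sub>R (f (t - u) - f t)
        = (1 - \<delta>) *\<^sub>R ?\<phi> u - u powr (\<delta> - 1) *\<^sub>R f' (t - u)"
      by (simp add: algebra_simps)
    ultimately show "(F has_vector_derivative (1 - \<delta>) *\<^sub>R ?\<phi> u - u powr (\<delta> - 1) *\<^sub>R f' (t - u)) (at u)" by simp
  qed (use t0 in auto)
  moreover have "((\<lambda>u. (1 - \<delta>) *\<^sub>R ?\<phi> u) has_integral ((1 - \<delta>) *\<^sub>R integral {0..t} ?\<phi>)) {0..t}"
    using split(1) by (intro has_integral_cmul integrable_integral)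
  ultimately have "((\<lambda>u. (1 - \<delta>) *\<^sub>R ?\<phi> u - ((1 - \<delta>) *\<^sub>R ?\<phi> u - u powr (\<delta> - 1) *\<^sub>R f' (t - u))) has_integral
       ((1 - \<delta>) *\<^sub>R integral {0..t} ?\<phi> - (F t - F 0))) {0..t}"
    by (rule has_integral_diff[rotated])
  moreover have "(1 - \<delta>) *\<^sub>R integral {0..t} ?\<phi> - (F t - F 0) = marchaud \<delta> f t"
    unfolding split(2) by (simp add: F_def algebra_simps)
  ultimately have "((\<lambda>u. u powr (\<delta> - 1) *\<^sub>R f' (t - u)) has_integral marchaud \<delta> f t) (cbox 0 t)"
    by simp
  from has_integral_affinity[OF this, of "-1" t]
  have "((\<lambda>s. (t - s) powr (\<delta> - 1) *\<^sub>R f' s) has_integral marchaud \<delta> f t) ((\<lambda>x. t - x) ` {0..t})"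
    by simp
  moreover have "(\<lambda>x. t - x) ` {0..t} = {0..t}" using t0 by simp
  ultimately have "((\<lambda>s. (t - s) powr (\<delta> - 1) *\<^sub>R f' s) has_integral marchaud \<delta> f t) {0..t}" by simp
  then have "((\<lambda>s. (t - s) powr (\<delta> - 1) *\<^sub>R vector_derivative f (at s within {0..T})) has_integral marchaud \<delta> f t) {0..t}"
  proof (rule has_integral_eq[rotated])
    fix s assume "s \<in> {0..t}"
    then have s: "s \<in> {0..T}" using t by auto
    have "vector_derivative f (at s within {0..T}) = f' s"
      by (rule vector_derivative_within_cbox[of 0 T s, simplified]) (use s T f'[OF s] in auto)
    then show "(t - s) powr (\<delta> - 1) *\<^sub>R f' s = (t - s) powr (\<delta> - 1) *\<^sub>R vector_derivative f (at s within {0..T})" by simp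
  qed
  then show ?thesis unfolding Xi_smooth_def by (rule integral_unique)
qed

section \<open>Density of smooth paths in weaker Hoelder norms\<close>

text \<open>Averaging over a window of length h keeps the Hoelder constant, since every translate of
  the path has it, and moves the path by at most its oscillation over the window. The mean has the
  continuous derivative q, recorded through its integrals because the polynomial approximation acts
  on q.\<close>

lemma steklov_approximation:
  fixes f :: "real \<Rightarrow> 'a::euclidean_space"
  assumes f: "holder_bound H a T f" and a: "0 < a" and T: "0 < T" and h: "0 < h"
  obtains g q where "continuous_on {0..T} q"
    "\<And>s t. 0 \<le> s \<Longrightarrow> s \<le> t \<Longrightarrow> t \<le> T \<Longrightarrow> g t - g s = integral {s..t} q"
    "holder_bound H a T g" "\<And>t. t \<in> {0..T} \<Longrightarrow> norm (g t - f t) \<le> H * h powr a"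
proof -
  note H = holder_bound_nonneg[OF f]
  \<comment> \<open>Clamping the argument extends the path to the whole line with the same Hoelder
    constant, so windows may reach beyond T.\<close>
  define e where "e r = f (max 0 (min T r))" for r
  have ce: "continuous_on S e" for S
    unfolding e_def
    by (rule continuous_on_compose2[OF holder_bound_continuous_on[OF f a]])
       (use T in \<open>auto intro!: continuous_intros\<close>)
  have ie: "e integrable_on {r..s}" for r s
    by (intro integrable_continuous_real ce)
  have he: "norm (e t - e s) \<le> H * (t - s) powr a" if "s \<le> t" for s t
  proof -
    have "norm (e t - e s) \<le> H * (max 0 (min T t) - max 0 (min T s)) powr a"
      unfolding e_def by (rule holder_boundD[OF f]) (use that T in auto)
    also have "\<dots> \<le> H * (t - s) powr a"
      using that a H by (intro mult_left_mono powr_mono2) auto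
    finally show ?thesis .
  qed
  define g where "g t = (1 / h) *\<^sub>R integral {0..h} (\<lambda>r. e (t + r))" for t
  define q where "q r = (1 / h) *\<^sub>R (e (r + h) - e r)" for r
  have ce': "continuous_on S (\<lambda>r. e (t + r))" for S t
    by (rule continuous_on_compose2[OF ce[of UNIV]]) (auto intro!: continuous_intros)
  have ce'': "continuous_on S (\<lambda>r. e (r + h))" for S
    by (rule continuous_on_compose2[OF ce[of UNIV]]) (auto intro!: continuous_intros)
  have mean: "norm ((1 / h) *\<^sub>R integral {0..h} \<phi>) \<le> B"
    if "continuous_on {0..h} \<phi>" "\<And>r. r \<in> {0..h} \<Longrightarrow> norm (\<phi> r) \<le> B" for B and \<phi> :: "real \<Rightarrow> 'a"
  proof -
    have "norm (integral {0..h} \<phi>) \<le> B * (h - 0)"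
      by (rule integral_bound) (use that h in auto)
    then show ?thesis using h by (simp add: field_simps)
  qed
  show thesis
  proof
    show "continuous_on {0..T} q"
      unfolding q_def by (intro continuous_on_scaleR continuous_on_diff continuous_on_const ce ce'')
    show "g t - g s = integral {s..t} q" if st: "0 \<le> s" "s \<le> t" "t \<le> T" for s t
    proof -
      have shift: "integral {0..h} (\<lambda>r. e (u + r)) = integral {u..u+h} e" for u
        using integral_shift_Icc_real[of 0 h e u] by (simp add: o_def add.commute)
      have shift': "integral {s..t} (\<lambda>r. e (r + h)) = integral {s+h..t+h} e"
        using integral_shift_Icc_real[of s t e h] by (simp add: o_def add.commute)
      have "integral {s..t} e + integral {t..t+h} e = integral {s..t+h} e"
        by (rule Henstock_Kurzweil_Integration.integral_combine) (use st h ie in auto)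
      moreover have "integral {s..s+h} e + integral {s+h..t+h} e = integral {s..t+h} e"
        by (rule Henstock_Kurzweil_Integration.integral_combine) (use st h ie in auto)
      ultimately have "integral {t..t+h} e - integral {s..s+h} e = integral {s+h..t+h} e - integral {s..t} e"
        by (simp add: algebra_simps)
      also have "\<dots> = integral {s..t} (\<lambda>r. e (r + h) - e r)"
        unfolding shift'[symmetric]
        by (intro Henstock_Kurzweil_Integration.integral_diff[symmetric] ie integrable_continuous_real
            ce'')
      finally show ?thesis
        unfolding g_def q_def shift by (simp add: scaleR_right_diff_distrib[symmetric] del: scaleR_right_diff_distrib)
    qed
    show "holder_bound H a T g"
    proof (rule holder_boundI[OF H])
      fix s t assume st: "0 \<le> s" "s \<le> t" "t \<le> T"
      have "g t - g s = (1 / h) *\<^sub>R integral {0..h} (\<lambda>r. e (t + r) - e (s + r))"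
        unfolding g_def
        by (subst Henstock_Kurzweil_Integration.integral_diff) (auto intro: integrable_continuous_real ce' simp: scaleR_right_diff_distrib)
      moreover have "norm ((1 / h) *\<^sub>R integral {0..h} (\<lambda>r. e (t + r) - e (s + r))) \<le> H * (t - s) powr a"
      proof (rule mean)
        show "norm (e (t + r) - e (s + r)) \<le> H * (t - s) powr a" for r
          using he[of "s + r" "t + r"] st by simp
      qed (intro continuous_on_diff ce')
      ultimately show "norm (g t - g s) \<le> H * (t - s) powr a" by simp
    qed
    show "norm (g t - f t) \<le> H * h powr a" if t: "t \<in> {0..T}" for t
    proof -
      have et: "e t = f t" unfolding e_def using t by (intro arg_cong[where f = f]) auto
      have "integral {0..h} (\<lambda>r. e (t + r) - e t) = integral {0..h} (\<lambda>r. e (t + r)) - integral {0..h} (\<lambda>r. e t)"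
        by (intro Henstock_Kurzweil_Integration.integral_diff integrable_continuous_real ce' continuous_on_const)
      also have "integral {0..h} (\<lambda>r. e t) = h *\<^sub>R e t" using h by simp
      finally have "g t - e t = (1 / h) *\<^sub>R integral {0..h} (\<lambda>r. e (t + r) - e t)"
        unfolding g_def using h by (simp add: scaleR_right_diff_distrib)
      moreover have "norm ((1 / h) *\<^sub>R integral {0..h} (\<lambda>r. e (t + r) - e t)) \<le> H * h powr a"
      proof (rule mean)
        show "continuous_on {0..h} (\<lambda>r. e (t + r) - e t)" by (intro continuous_intros ce')
        fix r assume r: "r \<in> {0..h}"
        have "norm (e (t + r) - e t) \<le> H * (t + r - t) powr a" by (rule he) (use r in auto)
        also have "\<dots> \<le> H * h powr a" using r a H by (intro mult_left_mono powr_mono2) auto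
        finally show "norm (e (t + r) - e t) \<le> H * h powr a" .
      qed
      ultimately show ?thesis by (simp add: et)
    qed
  qed
qed

text \<open>The gap b < a drives the method: the mean need not be close to the path at exponent a,
  but interpolation between a bounded a-seminorm and a small supremum makes the difference small at
  exponent b. A polynomial then replaces the derivative of the mean uniformly, so its antiderivative
  is close to the mean in the Lipschitz sense.\<close>

lemma smooth_approximation:
  fixes f :: "real \<Rightarrow> 'a::euclidean_space"
  assumes f: "holder_bound H a T f" and b: "0 \<le> b" "b < a" "b \<le> 1" and T: "0 < T" and e: "0 < e"
  obtains g where "smooth_on_int T g" "holder_bound e b T (\<lambda>t. g t - f t)"
    "\<And>t. t \<in> {0..T} \<Longrightarrow> norm (g t - f t) \<le> e"
proof -
  note H = holder_bound_nonneg[OF f]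
  have "((\<lambda>h. 2 * H * h powr (a - b)) \<longlongrightarrow> 2 * H * 0 powr (a - b)) (at_right 0)"
    using b by (intro tendsto_intros) (auto simp: eventually_at_filter)
  then have "\<forall>\<^sub>F h in at_right 0. 2 * H * h powr (a - b) < e / 2"
    using e by (intro order_tendstoD(2)) auto
  moreover have "((\<lambda>h. H * h powr a) \<longlongrightarrow> H * 0 powr a) (at_right 0)"
    using b by (intro tendsto_intros) (auto simp: eventually_at_filter)
  then have "\<forall>\<^sub>F h in at_right 0. H * h powr a < e / 2"
    using e by (intro order_tendstoD(2)) auto
  moreover have "\<forall>\<^sub>F h in at_right 0. (0::real) < h" by (rule eventually_at_right_less)
  ultimately have "\<forall>\<^sub>F h in at_right 0. 2 * H * h powr (a - b) < e / 2 \<and> H * h powr a < e / 2 \<and> 0 < h"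
    by eventually_elim auto
  then obtain h where h: "2 * H * h powr (a - b) < e / 2" "H * h powr a < e / 2" "0 < h"
    using eventually_happens'[OF trivial_limit_at_right_real] by blast
  have a: "0 < a" using b by simp
  obtain g q where q: "continuous_on {0..T} q"
    and gq: "\<And>s t. 0 \<le> s \<Longrightarrow> s \<le> t \<Longrightarrow> t \<le> T \<Longrightarrow> g t - g s = integral {s..t} q"
    and g: "holder_bound H a T g" "\<And>t. t \<in> {0..T} \<Longrightarrow> norm (g t - f t) \<le> H * h powr a"
    by (rule steklov_approximation[OF f a T h(3)]) (rule that)
  \<comment> \<open>Half of e is reserved for the polynomial error: a Lipschitz constant m costs m *
    T powr (1 - b) at exponent b and m * T in the supremum.\<close>
  define m where "m = min (e / (2 * T powr (1 - b))) (e / (2 * T))"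
  have m: "0 < m" using e T by (auto simp: m_def)
  obtain p where p: "polynomial_function p" "\<And>x. x \<in> {0..T} \<Longrightarrow> norm (q x - p x) < m"
    using Stone_Weierstrass_polynomial_function[OF _ q m] by auto
  define P where "P t = g 0 + integral {0..t} p" for t
  have ip: "p integrable_on {r..s}" for r s
    by (intro integrable_continuous_real continuous_on_polymonial_function p)
  have iq: "q integrable_on {r..s}" if "0 \<le> r" "s \<le> T" for r s
    by (intro integrable_continuous_real continuous_on_subset[OF q]) (use that in auto)
  have Pg: "holder_bound m 1 T (\<lambda>t. P t - g t)"
  proof (rule holder_boundI)
    fix s t assume st: "0 \<le> s" "s \<le> t" "t \<le> T"
    have "integral {0..s} p + integral {s..t} p = integral {0..t} p"
      by (rule Henstock_Kurzweil_Integration.integral_combine) (use st ip in auto)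
    then have "P t - P s = integral {s..t} p" by (simp add: P_def algebra_simps)
    then have "(P t - g t) - (P s - g s) = integral {s..t} p - integral {s..t} q"
      using gq[OF st] by (simp add: algebra_simps)
    also have "\<dots> = integral {s..t} (\<lambda>r. p r - q r)"
      by (rule Henstock_Kurzweil_Integration.integral_diff[symmetric]) (use ip iq st in auto)
    also have "norm \<dots> \<le> m * (t - s)"
    proof (rule integral_bound)
      show "continuous_on {s..t} (\<lambda>r. p r - q r)"
        by (intro continuous_on_diff continuous_on_polymonial_function p continuous_on_subset[OF q])
           (use st in auto)
      show "norm (p r - q r) \<le> m" if "r \<in> {s..t}" for r
        using p(2)[of r] st that by (simp add: norm_minus_commute less_imp_le)
    qed (use st in auto)
    finally show "norm ((P t - g t) - (P s - g s)) \<le> m * (t - s) powr 1" using st by simp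
  qed (use m in auto)
  show thesis
  proof
    show "smooth_on_int T P" unfolding P_def by (rule smooth_on_int_antiderivative[OF p(1)])
    show "norm (P t - f t) \<le> e" if t: "t \<in> {0..T}" for t
    proof -
      have "norm ((P t - g t) - (P 0 - g 0)) \<le> m * (t - 0) powr 1"
        by (rule holder_boundD[OF Pg]) (use t in auto)
      also have "\<dots> \<le> m * T" using t m by auto
      also have "\<dots> \<le> (e / (2 * T)) * T" using T unfolding m_def by (intro mult_right_mono) auto
      also have "\<dots> = e / 2" using T by simp
      finally have "norm (P t - g t) \<le> e / 2" by (simp add: P_def)
      moreover have "norm (g t - f t) \<le> e / 2" using g(2)[OF t] h by simp
      moreover have "norm (P t - f t) \<le> norm (P t - g t) + norm (g t - f t)"
        using norm_triangle_ineq[of "P t - g t" "g t - f t"] by simp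
      ultimately show ?thesis by linarith
    qed
    show "holder_bound e b T (\<lambda>t. P t - f t)"
    proof (rule holder_boundI)
      fix s t assume st: "0 \<le> s" "s \<le> t" "t \<le> T"
      have "norm ((P t - g t) - (P s - g s)) \<le> (m * T powr (1 - b)) * (t - s) powr b"
        using holder_boundD[OF holder_bound_weaken[OF Pg b(3) T] st] .
      also have "\<dots> \<le> (e / (2 * T powr (1 - b)) * T powr (1 - b)) * (t - s) powr b"
        unfolding m_def by (intro mult_right_mono) auto
      also have "\<dots> = e / 2 * (t - s) powr b" using T by simp
      finally have 1: "norm ((P t - g t) - (P s - g s)) \<le> e / 2 * (t - s) powr b" .
      have "norm ((g t - f t) - (g s - f s)) \<le> 2 * H * h powr (a - b) * (t - s) powr b"
      \<comment> \<open>Up to scale h the Hoelder bounds of f and g apply, beyond it the supremum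
        bound of g - f; either way the surplus power is h powr (a - b).\<close>
      proof (cases "t - s \<le> h")
        case True
        have "norm ((g t - g s) - (f t - f s)) \<le> norm (g t - g s) + norm (f t - f s)"
          by (rule norm_triangle_ineq4)
        also have "\<dots> \<le> 2 * H * (t - s) powr a"
          using holder_boundD[OF g(1) st] holder_boundD[OF f st] by simp
        also have "\<dots> = 2 * H * ((t - s) powr (a - b) * (t - s) powr b)"
          by (simp add: powr_add[symmetric])
        also have "\<dots> \<le> 2 * H * (h powr (a - b) * (t - s) powr b)"
          using True st H b by (intro mult_left_mono mult_right_mono powr_mono2) auto
        finally show ?thesis by (simp add: algebra_simps)
      next
        case False
        have "norm ((g t - f t) - (g s - f s)) \<le> norm (g t - f t) + norm (g s - f s)"
          by (rule norm_triangle_ineq4)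
        also have "\<dots> \<le> 2 * H * h powr a" using g(2)[of t] g(2)[of s] st by simp
        also have "\<dots> = 2 * H * (h powr (a - b) * h powr b)"
          by (simp add: powr_add[symmetric])
        also have "\<dots> \<le> 2 * H * (h powr (a - b) * (t - s) powr b)"
          using False h H b by (intro mult_left_mono powr_mono2) auto
        finally show ?thesis by simp
      qed
      also have "\<dots> \<le> e / 2 * (t - s) powr b" using h by (intro mult_right_mono) auto
      finally have 2: "norm ((g t - f t) - (g s - f s)) \<le> e / 2 * (t - s) powr b" .
      have "(P t - f t) - (P s - f s) = ((P t - g t) - (P s - g s)) + ((g t - f t) - (g s - f s))"
        by simp
      then have "norm ((P t - f t) - (P s - f s)) \<le> norm ((P t - g t) - (P s - g s)) + norm ((g t - f t) - (g s - f s))"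
        by (metis norm_triangle_ineq)
      then show "norm ((P t - f t) - (P s - f s)) \<le> e * (t - s) powr b"
        using 1 2 by linarith
    qed (use e in auto)
  qed
qed

section \<open>The extension \<open>Xi\<close> on Hoelder paths\<close>

lemma holder_norm_le:
  assumes f: "holder_bound H a T f" and T: "0 < T" and B: "\<And>t. t \<in> {0..T} \<Longrightarrow> norm (f t) \<le> B"
  shows "holder_norm a T f \<le> B + H"
  unfolding holder_norm_def
proof (rule add_mono)
  show "(SUP t\<in>{0..T}. norm (f t)) \<le> B" by (rule cSUP_least) (use T B in auto)
  show "(SUP st\<in>{(s, t). 0 \<le> s \<and> s < t \<and> t \<le> T}. norm (f (snd st) - f (fst st)) / (snd st - fst st) powr a) \<le> H"
  proof (rule cSUP_least)
    have "(0, T) \<in> {(s, t). 0 \<le> s \<and> s < t \<and> t \<le> T}" using T by simp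
    then show "{(s, t). 0 \<le> s \<and> s < t \<and> t \<le> T} \<noteq> {}" by blast
    fix st assume "st \<in> {(s, t). 0 \<le> s \<and> s < t \<and> t \<le> T}"
    then show "norm (f (snd st) - f (fst st)) / (snd st - fst st) powr a \<le> H"
      using holder_boundD[OF f, of "fst st" "snd st"] by (auto simp: divide_simps)
  qed
qed

text \<open>A real supremum carries information only over a bounded set. The constant H provides
  boundedness, after which the norm itself serves as a Hoelder constant; this turns convergence in
  \<open>holder_norm\<close> into estimates.\<close>

lemma holder_bound_holder_norm:
  assumes f: "holder_bound H a T f" and T: "0 < T" and a: "0 \<le> a"
  shows "holder_bound (holder_norm a T f) a T f"
proof -
  let ?S = "{(s, t). 0 \<le> s \<and> s < t \<and> t \<le> T}"
  let ?q = "\<lambda>st. norm (f (snd st) - f (fst st)) / (snd st - fst st) powr a"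
  have bdd: "bdd_above (?q ` ?S)"
  proof (rule bdd_aboveI2)
    fix st assume "st \<in> ?S"
    then show "?q st \<le> H"
      using holder_boundD[OF f, of "fst st" "snd st"] by (auto simp: divide_simps)
  qed
  have sup1: "0 \<le> (SUP t\<in>{0..T}. norm (f t))"
  proof (rule cSUP_upper2)
    show "bdd_above ((\<lambda>t. norm (f t)) ` {0..T})"
    proof (rule bdd_aboveI2)
      fix t assume t: "t \<in> {0..T}"
      have "norm (f t - f 0) \<le> H * (t - 0) powr a" by (rule holder_boundD[OF f]) (use t in auto)
      also have "\<dots> \<le> H * T powr a"
        using t a holder_bound_nonneg[OF f] by (intro mult_left_mono powr_mono2) auto
      finally show "norm (f t) \<le> norm (f 0) + H * T powr a"
        using norm_triangle_sub[of "f t" "f 0"] by linarith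
    qed
    show "0 \<in> {0..T}" using T by simp
  qed simp
  have le: "?q (s, t) \<le> holder_norm a T f" if "0 \<le> s" "s < t" "t \<le> T" for s t
  proof -
    have "?q (s, t) \<le> (SUP st\<in>?S. ?q st)" by (rule cSUP_upper[OF _ bdd]) (use that in simp)
    then show ?thesis using sup1 unfolding holder_norm_def by linarith
  qed
  show ?thesis
  proof (rule holder_boundI)
    have "0 \<le> ?q (0, T)" using T by simp
    then show "0 \<le> holder_norm a T f" using le[of 0 T] T by linarith
    fix s t assume st: "0 \<le> s" "s \<le> t" "t \<le> T"
    show "norm (f t - f s) \<le> holder_norm a T f * (t - s) powr a"
    proof (cases "s = t")
      case False
      then show ?thesis using le[of s t] st by (simp add: divide_simps)
    qed simp
  qed
qed

lemma Xi_smooth_tendsto_marchaud: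
  fixes f :: "real \<Rightarrow> 'a::euclidean_space"
  assumes \<delta>: "0 < \<delta>" "\<delta> < 1" and T: "0 < T" and a: "1 - \<delta> < a" "a < 1" and f: "holder a T f"
    and fs: "\<And>n. smooth_on_int T (fs n)"
    and lim: "(\<lambda>n. holder_norm a T (\<lambda>t. fs n t - f t)) \<longlonglongrightarrow> 0"
    and t: "t \<in> {0..T}"
  shows "(\<lambda>n. Xi_smooth \<delta> T (fs n) t) \<longlonglongrightarrow> marchaud \<delta> f t"
proof -
  obtain H where H: "holder_bound H a T f" using f holder_iff_holder_bound by blast
  let ?N = "\<lambda>n. holder_norm a T (\<lambda>t. fs n t - f t)"
  have le: "norm (Xi_smooth \<delta> T (fs n) t - marchaud \<delta> f t) \<le> marchaud_const \<delta> a * ?N n * t powr (a + \<delta> - 1)" for n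
  proof -
    obtain f' where "continuous_on {0..T} f'"
      "\<And>s. s \<in> {0..T} \<Longrightarrow> (fs n has_vector_derivative f' s) (at s within {0..T})"
      using smooth_on_int_derivative[OF fs] by blast
    then obtain L where L: "holder_bound L 1 T (fs n)" using holder_bound_of_derivative by blast
    have La: "holder_bound (L * T powr (1 - a)) a T (fs n)"
      by (rule holder_bound_weaken[OF L]) (use a T in auto)
    have "holder_bound (L * T powr (1 - a) + H) a T (\<lambda>t. fs n t - f t)"
      by (rule holder_bound_diff[OF La H])
    then have "holder_bound (?N n) a T (\<lambda>t. fs n t - f t)"
      by (rule holder_bound_holder_norm) (use T a \<delta> in auto)
    then have "holder_bound (marchaud_const \<delta> a * ?N n) (a + \<delta> - 1) T (marchaud \<delta> (\<lambda>t. fs n t - f t))"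
      by (rule marchaud_holder_bound) (use \<delta> a in auto)
    then have "norm (marchaud \<delta> (\<lambda>t. fs n t - f t) t - marchaud \<delta> (\<lambda>t. fs n t - f t) 0)
        \<le> marchaud_const \<delta> a * ?N n * (t - 0) powr (a + \<delta> - 1)"
      by (rule holder_boundD) (use t in auto)
    moreover have "marchaud \<delta> (\<lambda>t. fs n t - f t) t = marchaud \<delta> (fs n) t - marchaud \<delta> f t"
    proof (rule marchaud_diff)
      show "holder_bound (L * T powr (1 - a)) a t (fs n)" "holder_bound H a t f"
        using La H t by (auto intro: holder_bound_mono)
    qed (use t \<delta> a in auto)
    ultimately show ?thesis
      using Xi_smooth_eq_marchaud[OF fs \<delta> T t] by (simp add: marchaud_0)
  qed
  have "(\<lambda>n. marchaud_const \<delta> a * ?N n * t powr (a + \<delta> - 1)) \<longlonglongrightarrow> marchaud_const \<delta> a * 0 * t powr (a + \<delta> - 1)"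
    by (intro tendsto_intros lim)
  then have "(\<lambda>n. marchaud_const \<delta> a * ?N n * t powr (a + \<delta> - 1)) \<longlonglongrightarrow> 0" by simp
  then have "(\<lambda>n. Xi_smooth \<delta> T (fs n) t - marchaud \<delta> f t) \<longlonglongrightarrow> 0"
    by (rule Lim_null_comparison[OF always_eventually, rotated]) (rule allI, rule le)
  then show ?thesis by (simp add: LIM_zero_iff)
qed

text \<open>The Marchaud form meets the description at every admissible exponent at once. Uniqueness
  needs one approximating sequence, and the exponent b halfway between 1 - \<delta> and a leaves
  room on both sides: below a for the approximation, above 1 - \<delta> for the continuity of
  \<Xi>.\<close>

lemma Xi_eq_marchaud:
  fixes f :: "real \<Rightarrow> 'a::euclidean_space"
  assumes \<delta>: "0 < \<delta>" "\<delta> < 1" and T: "0 < T" and a: "1 - \<delta> < a" "a < 1" and f: "holder_bound H a T f"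
    and t: "t \<in> {0..T}"
  shows "Xi \<delta> T f t = marchaud \<delta> f t"
proof -
  define b where "b = (1 - \<delta> + a) / 2"
  have b: "1 - \<delta> < b" "b < a" "0 \<le> b" "b < 1" using a \<delta> by (auto simp: b_def)
  have "\<exists>g. smooth_on_int T g \<and> holder_bound (1 / Suc n) b T (\<lambda>t. g t - f t) \<and>
      (\<forall>t\<in>{0..T}. norm (g t - f t) \<le> 1 / Suc n)" for n
    by (rule smooth_approximation[OF f b(3,2) _ T, of "1 / Suc n"]) (use b in auto)
  then obtain fs where fs: "\<And>n. smooth_on_int T (fs n)"
    "\<And>n. holder_bound (1 / Suc n) b T (\<lambda>t. fs n t - f t)"
    "\<And>n t. t \<in> {0..T} \<Longrightarrow> norm (fs n t - f t) \<le> 1 / Suc n"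
    by metis
  have lim: "(\<lambda>n. holder_norm b T (\<lambda>t. fs n t - f t)) \<longlonglongrightarrow> 0"
  proof (rule Lim_null_comparison)
    have "norm (holder_norm b T (\<lambda>t. fs n t - f t)) \<le> 1 / Suc n + 1 / Suc n" for n
      using holder_norm_le[OF fs(2) T fs(3)] holder_bound_nonneg[OF holder_bound_holder_norm[OF fs(2) T b(3)], of n]
      by simp
    then show "\<forall>\<^sub>F n in sequentially. norm (holder_norm b T (\<lambda>t. fs n t - f t)) \<le> 1 / Suc n + 1 / Suc n"
      by simp
    have "(\<lambda>n. 1 / real (Suc n) + 1 / real (Suc n)) \<longlonglongrightarrow> 0 + 0"
      by (intro tendsto_add LIMSEQ_Suc lim_1_over_n)
    then show "(\<lambda>n. 1 / real (Suc n) + 1 / real (Suc n)) \<longlonglongrightarrow> 0" by simp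
  qed
  have fb: "holder b T f"
    using holder_bound_weaken[OF f _ T, of b] b holder_iff_holder_bound by fastforce
  have "Xi \<delta> T f = (\<lambda>t. if t \<in> {0..T} then marchaud \<delta> f t else 0)"
    unfolding Xi_def
  proof (rule the_equality, intro conjI allI impI ballI, goal_cases)
    case (2 \<alpha>'' fs t)
    then show ?case using Xi_smooth_tendsto_marchaud[OF \<delta> T, of \<alpha>'' f fs t] by auto
  next
    case (3 g)
    show ?case
    proof
      fix t
      show "g t = (if t \<in> {0..T} then marchaud \<delta> f t else 0)"
      proof (cases "t \<in> {0..T}")
        case True
        then have "(\<lambda>n. Xi_smooth \<delta> T (fs n) t) \<longlonglongrightarrow> g t" using 3 b fs(1) lim fb by blast
        moreover have "(\<lambda>n. Xi_smooth \<delta> T (fs n) t) \<longlonglongrightarrow> marchaud \<delta> f t"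
          by (rule Xi_smooth_tendsto_marchaud[OF \<delta> T b(1,4) fb fs(1) lim True])
        ultimately show ?thesis using True LIMSEQ_unique by auto
      qed (use 3 in auto)
    qed
  qed auto
  then show ?thesis using t by simp
qed

section \<open>The sewing lemma\<close>

text \<open>The sewing condition on a germ; the requirement \<theta> > 1 is supplied separately.
  Taking s = u = t forces \<Gamma> s s = 0, which allows partitions with repeated points and so the
  stopping and clamping used below.\<close>

definition almost_additive :: "real \<Rightarrow> real \<Rightarrow> real \<Rightarrow> (real \<Rightarrow> real \<Rightarrow> 'a::real_normed_vector) \<Rightarrow> bool" where
  "almost_additive K \<theta> T \<Gamma> \<longleftrightarrow> 0 \<le> K \<and> (\<forall>s u t. 0 \<le> s \<and> s \<le> u \<and> u \<le> t \<and> t \<le> T \<longrightarrow>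
     norm (\<Gamma> s t - \<Gamma> s u - \<Gamma> u t) \<le> K * (t - s) powr \<theta>)"

lemma almost_additiveD:
  assumes "almost_additive K \<theta> T \<Gamma>" "0 \<le> s" "s \<le> u" "u \<le> t" "t \<le> T"
  shows "norm (\<Gamma> s t - \<Gamma> s u - \<Gamma> u t) \<le> K * (t - s) powr \<theta>"
  using assms unfolding almost_additive_def by auto

lemma almost_additive_refl:
  assumes "almost_additive K \<theta> T \<Gamma>" "0 \<le> s" "s \<le> T"
  shows "\<Gamma> s s = 0"
  using almost_additiveD[OF assms(1,2), of s s] assms by simp

definition sewing_const :: "real \<Rightarrow> real" where
  "sewing_const \<theta> = 2 / (1 - 2 powr (1 - \<theta>))"

lemma sewing_const:
  assumes "1 < \<theta>"
  shows "0 < sewing_const \<theta>" "2 + 2 * sewing_const \<theta> * (1 / 2) powr \<theta> = sewing_const \<theta>"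
proof -
  have "2 powr (1 - \<theta>) < 2 powr (0::real)" using assms by (intro powr_less_mono) auto
  then have lt: "2 powr (1 - \<theta>) < 1" by simp
  then show "0 < sewing_const \<theta>" by (simp add: sewing_const_def)
  have e: "2 * (1 / 2) powr \<theta> = 2 powr (1 - \<theta>)" by (simp add: powr_diff powr_divide)
  have "2 + 2 * sewing_const \<theta> * (1 / 2) powr \<theta> = 2 + sewing_const \<theta> * 2 powr (1 - \<theta>)"
    by (simp add: e[symmetric])
  also have "\<dots> = sewing_const \<theta>"
  proof -
    define x :: real where "x = 2 powr (1 - \<theta>)"
    have "1 - x \<noteq> 0" using lt unfolding x_def by linarith
    then show ?thesis unfolding sewing_const_def x_def[symmetric] using assms by (simp add: field_simps)
  qed
  finally show "2 + 2 * sewing_const \<theta> * (1 / 2) powr \<theta> = sewing_const \<theta>" .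
qed

lemma ex_straddling_index:
  fixes p :: "nat \<Rightarrow> real"
  assumes "0 < n" "p 0 \<le> m" "m \<le> p n"
  obtains j where "j < n" "p j \<le> m" "m \<le> p (Suc j)"
proof (rule ccontr)
  assume "\<not> thesis"
  then have *: "\<And>j. j < n \<Longrightarrow> p j \<le> m \<Longrightarrow> p (Suc j) < m" using that by force
  have "p j \<le> m" if "j \<le> n" for j
    using that by (induction j) (use assms * in \<open>auto simp: less_imp_le\<close>)
  then have "p (Suc (n - 1)) < m" using assms by (intro *) auto
  then show False using assms by simp
qed

text \<open>Cutting a partition at the cell that contains the midpoint leaves two partitions of
  intervals of at most half the length, so the constants satisfy the recursion
  \<open>c = 2 + 2 * c * 2 powr - \<theta>\<close>, which has a solution because \<open>\<theta> > 1\<close>.\<close>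

lemma sewing_sum_bound:
  fixes \<Gamma> :: "real \<Rightarrow> real \<Rightarrow> 'a::real_normed_vector"
  assumes \<Gamma>: "almost_additive K \<theta> T \<Gamma>" and \<theta>: "1 < \<theta>"
    and p: "mono p" "0 \<le> p 0" "p n \<le> T"
  shows "norm ((\<Sum>i<n. \<Gamma> (p i) (p (Suc i))) - \<Gamma> (p 0) (p n)) \<le> sewing_const \<theta> * K * (p n - p 0) powr \<theta>"
  using p
proof (induction n arbitrary: p rule: less_induct)
  case (less n)
  have K: "0 \<le> K" using \<Gamma> by (simp add: almost_additive_def)
  let ?c = "sewing_const \<theta>"
  note c = sewing_const[OF \<theta>]
  have mp: "p i \<le> p j" if "i \<le> j" for i j using less.prems(1) that by (rule monoD)
  show ?case
  proof (cases "n = 0")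
    case True
    then show ?thesis using almost_additive_refl[OF \<Gamma>, of "p 0"] less.prems by simp
  next
    case False
    define L where "L = p n - p 0"
    have L: "0 \<le> L" using mp[of 0 n] by (simp add: L_def)
    obtain j where j: "j < n" "p j \<le> (p 0 + p n) / 2" "(p 0 + p n) / 2 \<le> p (Suc j)"
      by (rule ex_straddling_index[of n p "(p 0 + p n) / 2"]) (use False mp[of 0 n] in auto)
    define k where "k = n - Suc j"
    have n: "n = Suc j + k" using j by (simp add: k_def)
    define q where "q i = p (Suc j + i)" for i
    have split: "(\<Sum>i<n. \<Gamma> (p i) (p (Suc i))) = (\<Sum>i<j. \<Gamma> (p i) (p (Suc i))) + \<Gamma> (p j) (p (Suc j))
        + (\<Sum>i<k. \<Gamma> (q i) (q (Suc i)))"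
      unfolding n q_def by (induction k) (auto simp: add.assoc)
    have le: "p 0 \<le> p j" "p j \<le> p (Suc j)" "p (Suc j) \<le> p n"
      using mp j by auto
    have half: "?c * K * r powr \<theta> \<le> ?c * K * (L powr \<theta> * (1 / 2) powr \<theta>)" if "0 \<le> r" "r \<le> L / 2" for r
    proof -
      have "r powr \<theta> \<le> (L / 2) powr \<theta>" using that \<theta> by (intro powr_mono2) auto
      also have "\<dots> = L powr \<theta> * (1 / 2) powr \<theta>" using L by (simp add: powr_divide)
      finally show ?thesis using c K by (intro mult_left_mono) auto
    qed
    have "norm ((\<Sum>i<j. \<Gamma> (p i) (p (Suc i))) - \<Gamma> (p 0) (p j)) \<le> ?c * K * (p j - p 0) powr \<theta>"
      by (rule less.IH) (use j less.prems mp[of j n] in auto)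
    also have "\<dots> \<le> ?c * K * (L powr \<theta> * (1 / 2) powr \<theta>)"
      by (rule half) (use j le in \<open>auto simp: L_def field_simps\<close>)
    finally have 1: "norm ((\<Sum>i<j. \<Gamma> (p i) (p (Suc i))) - \<Gamma> (p 0) (p j)) \<le> ?c * K * (L powr \<theta> * (1 / 2) powr \<theta>)" .
    have "norm ((\<Sum>i<k. \<Gamma> (q i) (q (Suc i))) - \<Gamma> (q 0) (q k)) \<le> ?c * K * (q k - q 0) powr \<theta>"
    proof (rule less.IH)
      show "mono q" unfolding q_def by (intro monoI mp) auto
      show "0 \<le> q 0" using le less.prems by (simp add: q_def)
      show "q k \<le> T" using less.prems n by (simp add: q_def)
    qed (use n in simp)
    also have "\<dots> \<le> ?c * K * (L powr \<theta> * (1 / 2) powr \<theta>)"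
      by (rule half) (use j le n in \<open>auto simp: L_def q_def field_simps\<close>)
    finally have 2: "norm ((\<Sum>i<k. \<Gamma> (q i) (q (Suc i))) - \<Gamma> (p (Suc j)) (p n)) \<le> ?c * K * (L powr \<theta> * (1 / 2) powr \<theta>)"
      by (simp add: q_def n)
    \<comment> \<open>Detaching the middle cell costs two defects, one at \<open>p j\<close> and one
      at \<open>p (Suc j)\<close>, each at most K * L powr \<theta>. They are the summand 2 in the
      recursion.\<close>
    have 3: "norm (\<Gamma> (p 0) (p n) - \<Gamma> (p 0) (p j) - \<Gamma> (p j) (p n)) \<le> K * L powr \<theta>"
      unfolding L_def by (rule almost_additiveD[OF \<Gamma>]) (use le less.prems in auto)
    have "norm (\<Gamma> (p j) (p n) - \<Gamma> (p j) (p (Suc j)) - \<Gamma> (p (Suc j)) (p n)) \<le> K * (p n - p j) powr \<theta>"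
      by (rule almost_additiveD[OF \<Gamma>]) (use le less.prems in auto)
    also have "\<dots> \<le> K * L powr \<theta>"
      unfolding L_def using le K \<theta> by (intro mult_left_mono powr_mono2) auto
    finally have 4: "norm (\<Gamma> (p j) (p n) - \<Gamma> (p j) (p (Suc j)) - \<Gamma> (p (Suc j)) (p n)) \<le> K * L powr \<theta>" .
    have "(\<Sum>i<n. \<Gamma> (p i) (p (Suc i))) - \<Gamma> (p 0) (p n)
       = ((\<Sum>i<j. \<Gamma> (p i) (p (Suc i))) - \<Gamma> (p 0) (p j)) + ((\<Sum>i<k. \<Gamma> (q i) (q (Suc i))) - \<Gamma> (p (Suc j)) (p n))
       - (\<Gamma> (p 0) (p n) - \<Gamma> (p 0) (p j) - \<Gamma> (p j) (p n)) - (\<Gamma> (p j) (p n) - \<Gamma> (p j) (p (Suc j)) - \<Gamma> (p (Suc j)) (p n))"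
      (is "_ = ?a + ?b - ?d - ?e") unfolding split by simp
    then have "norm ((\<Sum>i<n. \<Gamma> (p i) (p (Suc i))) - \<Gamma> (p 0) (p n)) = norm (?a + ?b - ?d - ?e)"
      by (rule arg_cong)
    also have "\<dots> \<le> norm ?a + norm ?b + norm ?d + norm ?e"
      using norm_triangle_ineq4[of "?a + ?b - ?d" ?e] norm_triangle_ineq4[of "?a + ?b" ?d] norm_triangle_ineq[of ?a ?b]
      by linarith
    also have "\<dots> \<le> K * L powr \<theta> * (2 + 2 * ?c * (1 / 2) powr \<theta>)"
      using 1 2 3 4 by (simp add: algebra_simps)
    also have "\<dots> = ?c * K * L powr \<theta>" unfolding c(2) by simp
    finally show ?thesis unfolding L_def .
  qed
qed

text \<open>Each cell contributes at most C * \<eta> powr (\<theta> - 1) times its length, and the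
  lengths telescope. The partition is arbitrary, so this also yields the Young limit along all
  partitions.\<close>

lemma sewing_error_bound:
  fixes \<Gamma> :: "real \<Rightarrow> real \<Rightarrow> 'a::real_normed_vector"
  assumes I: "\<And>s t. 0 \<le> s \<Longrightarrow> s \<le> t \<Longrightarrow> t \<le> T \<Longrightarrow> norm (I t - I s - \<Gamma> s t) \<le> C * (t - s) powr \<theta>"
    and C: "0 \<le> C" and \<theta>: "1 < \<theta>"
    and p: "\<And>i. i < n \<Longrightarrow> p i \<le> p (Suc i)" "0 \<le> p 0" "p n \<le> T"
    and \<eta>: "\<And>i. i < n \<Longrightarrow> p (Suc i) - p i \<le> \<eta>"
  shows "norm ((\<Sum>i<n. \<Gamma> (p i) (p (Suc i))) - (I (p n) - I (p 0))) \<le> C * \<eta> powr (\<theta> - 1) * (p n - p 0)"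
  using p \<eta>
proof (induction n)
  case (Suc n)
  have le: "p 0 \<le> p m" if "m \<le> n" for m
    using that by (induction m) (use Suc.prems(1) in \<open>auto intro: order_trans\<close>)
  let ?d = "p (Suc n) - p n"
  have d: "0 \<le> ?d" "?d \<le> \<eta>" using Suc.prems by auto
  then have pn: "p n \<le> T" using Suc.prems(3) by linarith
  have IH: "norm ((\<Sum>i<n. \<Gamma> (p i) (p (Suc i))) - (I (p n) - I (p 0))) \<le> C * \<eta> powr (\<theta> - 1) * (p n - p 0)"
    by (rule Suc.IH) (use Suc.prems pn in auto)
  have "norm (I (p (Suc n)) - I (p n) - \<Gamma> (p n) (p (Suc n))) \<le> C * ?d powr \<theta>"
    by (rule I) (use Suc.prems le[of n] in auto)
  also have "?d powr \<theta> = ?d powr (\<theta> - 1) * ?d powr 1" by (subst powr_add[symmetric]) simp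
  also have "C * \<dots> \<le> C * (\<eta> powr (\<theta> - 1) * ?d)"
    using d \<theta> C by (intro mult_left_mono mult_mono powr_mono2) auto
  finally have "norm (\<Gamma> (p n) (p (Suc n)) - (I (p (Suc n)) - I (p n))) \<le> C * \<eta> powr (\<theta> - 1) * ?d"
    by (simp add: norm_minus_commute)
  then have "norm (((\<Sum>i<n. \<Gamma> (p i) (p (Suc i))) - (I (p n) - I (p 0))) + (\<Gamma> (p n) (p (Suc n)) - (I (p (Suc n)) - I (p n))))
      \<le> C * \<eta> powr (\<theta> - 1) * (p n - p 0) + C * \<eta> powr (\<theta> - 1) * ?d"
    using IH norm_triangle_ineq[of "(\<Sum>i<n. \<Gamma> (p i) (p (Suc i))) - (I (p n) - I (p 0))" "\<Gamma> (p n) (p (Suc n)) - (I (p (Suc n)) - I (p n))"]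
    by linarith
  then show ?case by (simp add: algebra_simps)
qed simp

lemma tendsto_mesh_powr:
  fixes L c C :: real
  assumes "1 < \<theta>" "0 \<le> L"
  shows "(\<lambda>n. C * (L / real (Suc n)) powr (\<theta> - 1) * c) \<longlonglongrightarrow> 0"
proof -
  have "(\<lambda>n. L / real (Suc n)) \<longlonglongrightarrow> 0"
    by (rule LIMSEQ_Suc) (rule lim_const_over_n)
  then have "(\<lambda>n. (L / real (Suc n)) powr (\<theta> - 1)) \<longlonglongrightarrow> 0 powr (\<theta> - 1)"
    by (rule tendsto_powr') (use assms in auto)
  then have "(\<lambda>n. C * (L / real (Suc n)) powr (\<theta> - 1) * c) \<longlonglongrightarrow> C * 0 powr (\<theta> - 1) * c"
    by (intro tendsto_mult tendsto_const)
  then show ?thesis by simp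
qed

text \<open>The constant improves by itself. Over n equal cells the sum of germs is within the
  sewing bound of \<Gamma> s t and within an error of order C * n powr (1 - \<theta>) of
  \<open>I t - I s\<close>; letting n grow removes C. This matters for differences of integrals,
  where the crude C does not shrink with the distance of the paths but K does.\<close>

lemma sewing_estimate:
  fixes \<Gamma> :: "real \<Rightarrow> real \<Rightarrow> 'a::real_normed_vector"
  assumes \<Gamma>: "almost_additive K \<theta> T \<Gamma>" and \<theta>: "1 < \<theta>"
    and I: "\<And>s t. 0 \<le> s \<Longrightarrow> s \<le> t \<Longrightarrow> t \<le> T \<Longrightarrow> norm (I t - I s - \<Gamma> s t) \<le> C * (t - s) powr \<theta>"
    and C: "0 \<le> C" and st: "0 \<le> s" "s \<le> t" "t \<le> T"
  shows "norm (I t - I s - \<Gamma> s t) \<le> sewing_const \<theta> * K * (t - s) powr \<theta>"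
proof (rule tendsto_lowerbound[OF _ always_eventually])
  let ?L = "t - s"
  have "(\<lambda>n. sewing_const \<theta> * K * ?L powr \<theta> + C * (?L / real (Suc n)) powr (\<theta> - 1) * ?L)
      \<longlonglongrightarrow> sewing_const \<theta> * K * ?L powr \<theta> + 0"
    using st by (intro tendsto_add tendsto_const tendsto_mesh_powr \<theta>) auto
  then show "(\<lambda>n. sewing_const \<theta> * K * ?L powr \<theta> + C * (?L / real (Suc n)) powr (\<theta> - 1) * ?L)
      \<longlonglongrightarrow> sewing_const \<theta> * K * ?L powr \<theta>" by simp
  show "\<forall>n. norm (I t - I s - \<Gamma> s t) \<le> sewing_const \<theta> * K * ?L powr \<theta> + C * (?L / real (Suc n)) powr (\<theta> - 1) * ?L"
  proof
    fix n
    define N where "N = Suc n"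
    define p where "p i = s + real i * (?L / real N)" for i
    have N: "real N > 0" by (simp add: N_def)
    have "mono p"
      unfolding p_def using st by (intro monoI add_left_mono mult_right_mono) auto
    moreover have "p 0 = s" "p N = t" "\<And>i. p (Suc i) - p i = ?L / real N"
      using N st by (auto simp: p_def algebra_simps add_divide_distrib diff_divide_distrib)
    ultimately have p: "mono p" "p 0 = s" "p N = t" "\<And>i. p (Suc i) - p i = ?L / real N" by auto
    have p': "p i \<le> p (Suc i)" for i using p(1) by (rule monoD) simp
    have "norm ((\<Sum>i<N. \<Gamma> (p i) (p (Suc i))) - \<Gamma> (p 0) (p N)) \<le> sewing_const \<theta> * K * (p N - p 0) powr \<theta>"
      by (rule sewing_sum_bound[OF \<Gamma> \<theta> p(1)]) (use p st in auto)
    moreover have "norm ((\<Sum>i<N. \<Gamma> (p i) (p (Suc i))) - (I (p N) - I (p 0))) \<le> C * (?L / real N) powr (\<theta> - 1) * (p N - p 0)"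
      by (rule sewing_error_bound[OF I C \<theta>]) (use p p' st in auto)
    moreover have "I t - I s - \<Gamma> s t = ((\<Sum>i<N. \<Gamma> (p i) (p (Suc i))) - \<Gamma> s t) - ((\<Sum>i<N. \<Gamma> (p i) (p (Suc i))) - (I t - I s))"
      by (simp add: algebra_simps)
    then have "norm (I t - I s - \<Gamma> s t) \<le> norm ((\<Sum>i<N. \<Gamma> (p i) (p (Suc i))) - \<Gamma> s t) + norm ((\<Sum>i<N. \<Gamma> (p i) (p (Suc i))) - (I t - I s))"
      by (metis norm_triangle_ineq4)
    ultimately show "norm (I t - I s - \<Gamma> s t) \<le> sewing_const \<theta> * K * ?L powr \<theta> + C * (?L / real (Suc n)) powr (\<theta> - 1) * ?L"
      unfolding p(2,3) N_def[symmetric] by linarith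
  qed
qed simp

text \<open>The integral is the limit of the Riemann sums along the dyadic partitions of \<open>[0, T]\<close>
  stopped at \<open>t\<close>; stopping one fixed sequence of partitions makes additivity in \<open>t\<close> almost exact.\<close>

theorem sewing_lemma:
  fixes \<Gamma> :: "real \<Rightarrow> real \<Rightarrow> 'a::banach"
  assumes \<Gamma>: "almost_additive K \<theta> T \<Gamma>" and \<theta>: "1 < \<theta>" and T: "0 < T"
  obtains I where "I 0 = 0"
    "\<And>s t. 0 \<le> s \<Longrightarrow> s \<le> t \<Longrightarrow> t \<le> T \<Longrightarrow> norm (I t - I s - \<Gamma> s t) \<le> sewing_const \<theta> * K * (t - s) powr \<theta>"
proof -
  have K: "0 \<le> K" using \<Gamma> by (simp add: almost_additive_def)
  note refl = almost_additive_refl[OF \<Gamma>]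
  define a where "a n i = real i * (T / 2 ^ n)" for n i :: nat
  have a0: "a n 0 = 0" and aT: "a n (2 ^ n) = T" for n by (auto simp: a_def)
  have a_diff: "a n (Suc i) - a n i = T / 2 ^ n" for n i by (simp add: a_def algebra_simps add_divide_distrib)
  have a_mono: "mono (a n)" for n using T by (auto simp: mono_def a_def intro!: divide_right_mono)
  have a_le: "a n i \<le> a n (Suc i)" for n i using a_mono by (rule monoD) simp
  have a_nonneg: "0 \<le> a n i" for n i using T by (simp add: a_def)
  have a_even: "a (Suc n) (2 * i) = a n i" for n i by (simp add: a_def)
  define D where "D n t = (\<Sum>i<2 ^ n. \<Gamma> (min (a n i) t) (min (a n (Suc i)) t))" for n t
  define \<epsilon> where "\<epsilon> n = 2 ^ n * (K * (T / 2 ^ n) powr \<theta>)" for n :: nat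
  have sum_error: "norm (sum f {..<2 ^ n}) \<le> \<epsilon> n"
    if "\<And>i. norm (f i) \<le> K * (T / 2 ^ n) powr \<theta>" for f :: "nat \<Rightarrow> 'a" and n
  proof -
    have "norm (sum f {..<2 ^ n}) \<le> (\<Sum>i<2 ^ n :: nat. K * (T / 2 ^ n) powr \<theta>)"
      by (rule sum_norm_le) (rule that)
    then show ?thesis by (simp add: \<epsilon>_def)
  qed
  have \<epsilon>: "\<epsilon> n = (K * T powr \<theta>) * (2 powr (1 - \<theta>)) ^ n" for n
  proof -
    have "(2 powr (1 - \<theta>)) ^ n = 2 powr (real n * (1 - \<theta>))" by (simp add: powr_power)
    also have "\<dots> = 2 powr real n / (2 powr (real n * \<theta>))" by (simp add: powr_diff algebra_simps)
    also have "2 powr (real n * \<theta>) = (2 ^ n) powr \<theta>" by (simp add: powr_powr powr_realpow[symmetric])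
    finally show ?thesis using T by (simp add: \<epsilon>_def powr_divide powr_realpow)
  qed
  have "2 powr (1 - \<theta>) < 2 powr (0::real)" using \<theta> by (intro powr_less_mono) auto
  then have "summable (\<lambda>n. (2 powr (1 - \<theta>)) ^ n)" by (intro summable_geometric) simp
  then have sum_\<epsilon>: "summable \<epsilon>" unfolding \<epsilon> by (rule summable_mult)
  have step: "norm (D (Suc n) t - D n t) \<le> \<epsilon> n" if t: "0 \<le> t" "t \<le> T" for n t
  proof -
    have pairs: "(\<Sum>i<2 * m. f i) = (\<Sum>i<m. f (2 * i) + f (Suc (2 * i)))" for f :: "nat \<Rightarrow> 'a" and m
      by (induction m) (auto simp: add.assoc)
    let ?b = "\<lambda>i. min (a n i) t" and ?m = "\<lambda>i. min (a (Suc n) (Suc (2 * i))) t"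
    have "D (Suc n) t = (\<Sum>i<2 ^ n. \<Gamma> (?b i) (?m i) + \<Gamma> (?m i) (?b (Suc i)))"
      unfolding D_def power_Suc pairs using a_even[of n "Suc _"] by (simp add: a_even)
    then have "D n t - D (Suc n) t = (\<Sum>i<2 ^ n. \<Gamma> (?b i) (?b (Suc i)) - \<Gamma> (?b i) (?m i) - \<Gamma> (?m i) (?b (Suc i)))"
      unfolding D_def by (simp add: sum_subtractf[symmetric] diff_diff_eq)
    also have "norm \<dots> \<le> \<epsilon> n"
    proof (rule sum_error)
      fix i
      have m: "a n i \<le> a (Suc n) (Suc (2 * i))" "a (Suc n) (Suc (2 * i)) \<le> a n (Suc i)"
        using a_le[of "Suc n" "2 * i"] a_le[of "Suc n" "Suc (2 * i)"] a_even[of n i] a_even[of n "Suc i"] by auto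
      have "norm (\<Gamma> (?b i) (?b (Suc i)) - \<Gamma> (?b i) (?m i) - \<Gamma> (?m i) (?b (Suc i))) \<le> K * (?b (Suc i) - ?b i) powr \<theta>"
        by (rule almost_additiveD[OF \<Gamma>]) (use m t a_nonneg[of n i] in auto)
      also have "\<dots> \<le> K * (T / 2 ^ n) powr \<theta>"
        using K \<theta> a_le[of n i] a_diff[of n i] by (intro mult_left_mono powr_mono2) auto
      finally show "norm (\<Gamma> (?b i) (?b (Suc i)) - \<Gamma> (?b i) (?m i) - \<Gamma> (?m i) (?b (Suc i))) \<le> K * (T / 2 ^ n) powr \<theta>" .
    qed
    finally show ?thesis by (simp add: norm_minus_commute)
  qed
  have conv: "convergent (\<lambda>n. D n t)" if t: "0 \<le> t" "t \<le> T" for t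
  proof -
    have "summable (\<lambda>n. D (Suc n) t - D n t)"
      by (rule summable_comparison_test'[OF sum_\<epsilon>]) (rule step[OF t])
    then have "convergent (\<lambda>n. \<Sum>i<n. D (Suc i) t - D i t)" by (simp add: summable_iff_convergent)
    then have "convergent (\<lambda>n. D n t - D 0 t)" by (simp add: sum_lessThan_telescope[of "\<lambda>i. D i t"])
    then have "convergent (\<lambda>n. (D n t - D 0 t) + D 0 t)" by (intro convergent_add convergent_const)
    then show ?thesis by simp
  qed
  define I where "I t = lim (\<lambda>n. D n t)" for t
  have I: "(\<lambda>n. D n t) \<longlonglongrightarrow> I t" if "0 \<le> t" "t \<le> T" for t
    using conv[OF that] unfolding I_def by (simp add: convergent_LIMSEQ_iff)
  show thesis
  proof
    have "D n 0 = 0" for n using a_nonneg refl[of 0] T by (simp add: D_def min_absorb2)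
    then show "I 0 = 0" by (simp add: I_def lim_const)
    fix s t assume st: "0 \<le> s" "s \<le> t" "t \<le> T"
    show "norm (I t - I s - \<Gamma> s t) \<le> sewing_const \<theta> * K * (t - s) powr \<theta>"
    proof (rule tendsto_le[OF trivial_limit_sequentially])
      show "(\<lambda>n. norm (D n t - D n s - \<Gamma> s t)) \<longlonglongrightarrow> norm (I t - I s - \<Gamma> s t)"
        using st by (intro tendsto_intros I) auto
      have "(\<lambda>n. \<epsilon> n + sewing_const \<theta> * K * (t - s) powr \<theta>) \<longlonglongrightarrow> 0 + sewing_const \<theta> * K * (t - s) powr \<theta>"
        by (intro tendsto_add tendsto_const summable_LIMSEQ_zero sum_\<epsilon>)
      then show "(\<lambda>n. \<epsilon> n + sewing_const \<theta> * K * (t - s) powr \<theta>) \<longlonglongrightarrow> sewing_const \<theta> * K * (t - s) powr \<theta>" by simp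
      have "norm (D n t - D n s - \<Gamma> s t) \<le> \<epsilon> n + sewing_const \<theta> * K * (t - s) powr \<theta>" for n
      proof -
        \<comment> \<open>The dyadic points clamped to [s, t] form a partition of it. Its sum of
          germs differs from \<open>D n t - D n s\<close> only in a cell that has s in its interior;
          on the other cells the terms cancel because \<Gamma> s s = 0. Charging \<epsilon> n, the
          defect of all cells, is generous but tends to 0.\<close>
        define p where "p i = max s (min (a n i) t)" for i
        have "mono p"
          unfolding p_def by (intro monoI max.mono min.mono order_refl monoD[OF a_mono])
        moreover have "p 0 = s" "p (2 ^ n) = t" using st by (auto simp: p_def a0 aT)
        ultimately have p: "mono p" "p 0 = s" "p (2 ^ n) = t" by auto
        have 1: "norm ((\<Sum>i<2 ^ n. \<Gamma> (p i) (p (Suc i))) - \<Gamma> s t) \<le> sewing_const \<theta> * K * (t - s) powr \<theta>"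
          using sewing_sum_bound[OF \<Gamma> \<theta> p(1), of "2 ^ n"] p st by simp
        have "D n t - D n s - (\<Sum>i<2 ^ n. \<Gamma> (p i) (p (Suc i)))
            = (\<Sum>i<2 ^ n. \<Gamma> (min (a n i) t) (min (a n (Suc i)) t) - \<Gamma> (min (a n i) s) (min (a n (Suc i)) s) - \<Gamma> (p i) (p (Suc i)))"
          unfolding D_def by (simp add: sum_subtractf)
        also have "norm \<dots> \<le> \<epsilon> n"
        proof (rule sum_error)
          fix i
          let ?a = "a n i" and ?b = "a n (Suc i)"
          let ?X = "\<Gamma> (min ?a t) (min ?b t) - \<Gamma> (min ?a s) (min ?b s) - \<Gamma> (p i) (p (Suc i))"
          have ab: "?a \<le> ?b" "?b - ?a = T / 2 ^ n" using a_le a_diff by auto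
          consider "?b \<le> s" | "s \<le> ?a" | "?a < s" "s < ?b" by linarith
          then show "norm ?X \<le> K * (T / 2 ^ n) powr \<theta>"
          proof cases
            case 1
            then have "?X = 0" using ab st refl[of s] by (simp add: p_def min_absorb1 max_absorb1)
            then show ?thesis using K by simp
          next
            case 2
            then have "?X = 0" using ab st refl[of s] by (simp add: p_def min_absorb2 max_absorb2)
            then show ?thesis using K by simp
          next
            case 3
            then have "?X = \<Gamma> ?a (min ?b t) - \<Gamma> ?a s - \<Gamma> s (min ?b t)"
              using ab st by (simp add: p_def min_absorb1 min_absorb2 max_absorb1 max_absorb2)
            also have "norm \<dots> \<le> K * (min ?b t - ?a) powr \<theta>"
              by (rule almost_additiveD[OF \<Gamma>]) (use 3 st a_nonneg in auto)
            also have "\<dots> \<le> K * (T / 2 ^ n) powr \<theta>"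
              using K \<theta> 3 st ab by (intro mult_left_mono powr_mono2) auto
            finally show ?thesis .
          qed
        qed
        finally have 2: "norm (D n t - D n s - (\<Sum>i<2 ^ n. \<Gamma> (p i) (p (Suc i)))) \<le> \<epsilon> n" .
        have "D n t - D n s - \<Gamma> s t = (D n t - D n s - (\<Sum>i<2 ^ n. \<Gamma> (p i) (p (Suc i)))) + ((\<Sum>i<2 ^ n. \<Gamma> (p i) (p (Suc i))) - \<Gamma> s t)" by simp
        then have "norm (D n t - D n s - \<Gamma> s t) \<le> norm (D n t - D n s - (\<Sum>i<2 ^ n. \<Gamma> (p i) (p (Suc i)))) + norm ((\<Sum>i<2 ^ n. \<Gamma> (p i) (p (Suc i))) - \<Gamma> s t)"
          by (metis norm_triangle_ineq)
        then show ?thesis using 1 2 by linarith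
      qed
      then show "\<forall>\<^sub>F n in sequentially. norm (D n t - D n s - \<Gamma> s t) \<le> \<epsilon> n + sewing_const \<theta> * K * (t - s) powr \<theta>" by simp
    qed
  qed
qed

section \<open>The nonlinear Young integral\<close>

text \<open>Completing a parallelogram: with w = b - q the point e = a - w satisfies e - q = a - b,
  so \<open>g a - g b - (g e - g q)\<close> is the increment from 0 to w of the function
  \<open>\<lambda>z. g (e + z) - g (q + z)\<close>, whose derivative is controlled by the Hoelder
  continuity of g'. What is left, \<open>g e - g p\<close>, is a Lipschitz term, and e - p is the
  second difference of the four points.\<close>

lemma four_point_bound:
  fixes g :: "'a::euclidean_space \<Rightarrow> 'a"
  assumes g: "\<And>x. (g has_derivative g' x) (at x)"
    and bound: "\<And>x. onorm (g' x) \<le> c"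
    and holder: "\<And>x y. onorm (\<lambda>v. g' x v - g' y v) \<le> c * norm (x - y) powr \<beta>"
  shows "norm (g a - g b - (g p - g q))
    \<le> c * (norm ((a - p) - (b - q)) + norm (a - b) powr \<beta> * norm (b - q))"
proof -
  define w where "w = b - q"
  define e where "e = a - w"
  have 1: "norm (g e - g p) \<le> c * norm (e - p)"
    by (rule differentiable_bound[of UNIV g g']) (use g bound in auto)
  have "norm ((g (e + w) - g (q + w)) - (g (e + 0) - g (q + 0))) \<le> c * norm (e - q) powr \<beta> * norm (w - 0)"
  proof (rule differentiable_bound[of UNIV "\<lambda>z. g (e + z) - g (q + z)" "\<lambda>z v. g' (e + z) v - g' (q + z) v"])
    fix z
    have "((\<lambda>z. g (u + z)) has_derivative g' (u + z)) (at z)" for u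
    proof -
      have "((\<lambda>z. u + z) has_derivative (\<lambda>v. v)) (at z)" by (auto intro!: derivative_eq_intros)
      from has_derivative_compose[OF this g] show ?thesis by simp
    qed
    then show "((\<lambda>z. g (e + z) - g (q + z)) has_derivative (\<lambda>v. g' (e + z) v - g' (q + z) v)) (at z)"
      by (intro has_derivative_diff)
    show "onorm (\<lambda>v. g' (e + z) v - g' (q + z) v) \<le> c * norm (e - q) powr \<beta>"
      using holder[of "e + z" "q + z"] by simp
  qed auto
  then have 2: "norm ((g a - g b) - (g e - g q)) \<le> c * norm (a - b) powr \<beta> * norm (b - q)"
    by (simp add: e_def w_def)
  have "g a - g b - (g p - g q) = ((g a - g b) - (g e - g q)) + (g e - g p)" by simp
  then have "norm (g a - g b - (g p - g q)) \<le> norm ((g a - g b) - (g e - g q)) + norm (g e - g p)"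
    by (metis norm_triangle_ineq)
  moreover have e: "e - p = (a - p) - (b - q)" by (simp add: e_def w_def)
  ultimately show ?thesis using 1 2 unfolding e distrib_left mult.assoc by linarith
qed

abbreviation increment :: "(real \<Rightarrow> 'a \<Rightarrow> 'a::real_normed_vector) \<Rightarrow> real \<Rightarrow> real \<Rightarrow> 'a \<Rightarrow> 'a" where
  "increment A s t x \<equiv> A t x - A s x"

text \<open>From here on these four estimates stand for the class. The mean value theorem turns the
  bounded gradient into the Lipschitz bound, and with the Hoelder continuity of the gradient into
  the four point bound. The absolute value settles the sign of the constant; s = t, outside the
  range of the class, is trivial.\<close>

lemma field_class_bounds:
  assumes "field_class \<alpha> \<beta> T A"
  obtains C where "0 \<le> C"
    "\<And>s t x. 0 \<le> s \<Longrightarrow> s \<le> t \<Longrightarrow> t \<le> T \<Longrightarrow> norm (increment A s t x) \<le> C * (t - s) powr \<alpha>"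
    "\<And>s t x y. 0 \<le> s \<Longrightarrow> s \<le> t \<Longrightarrow> t \<le> T \<Longrightarrow>
       norm (increment A s t x - increment A s t y) \<le> C * (t - s) powr \<alpha> * norm (x - y) powr \<beta>"
    "\<And>s t x y. 0 \<le> s \<Longrightarrow> s \<le> t \<Longrightarrow> t \<le> T \<Longrightarrow>
       norm (increment A s t x - increment A s t y) \<le> C * (t - s) powr \<alpha> * norm (x - y)"
    "\<And>s t a b p q. 0 \<le> s \<Longrightarrow> s \<le> t \<Longrightarrow> t \<le> T \<Longrightarrow>
       norm (increment A s t a - increment A s t b - (increment A s t p - increment A s t q))
         \<le> C * (t - s) powr \<alpha> * (norm ((a - p) - (b - q)) + norm (a - b) powr \<beta> * norm (b - q))"
proof -
  obtain C DA where DA: "\<And>t x. t \<in> {0..T} \<Longrightarrow> (A t has_derivative DA t x) (at x)"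
    and C: "\<And>s t x y. 0 \<le> s \<Longrightarrow> s < t \<Longrightarrow> t \<le> T \<Longrightarrow>
           norm (A t x - A s x) \<le> C * (t - s) powr \<alpha> \<and>
           norm ((A t x - A s x) - (A t y - A s y)) \<le> C * (t - s) powr \<alpha> * norm (x - y) powr \<beta> \<and>
           onorm (\<lambda>v. DA t x v - DA s x v) \<le> C * (t - s) powr \<alpha> \<and>
           onorm (\<lambda>v. (DA t x v - DA s x v) - (DA t y v - DA s y v))
              \<le> C * (t - s) powr \<alpha> * norm (x - y) powr \<beta>"
    using assms unfolding field_class_def by blast
  have deriv: "(increment A s t has_derivative (\<lambda>v. DA t x v - DA s x v)) (at x)"
    if "s \<in> {0..T}" "t \<in> {0..T}" for s t x
    by (intro has_derivative_diff DA that)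
  have le: "C * (t - s) powr \<alpha> \<le> \<bar>C\<bar> * (t - s) powr \<alpha>" for s t by (intro mult_right_mono) auto
  show thesis
  proof
    show "0 \<le> \<bar>C\<bar>" by simp
    fix s t a b p q assume st: "0 \<le> s" "s \<le> t" "t \<le> T"
    let ?g = "increment A s t" and ?c = "\<bar>C\<bar> * (t - s) powr \<alpha>"
    show "norm (?g a) \<le> ?c"
    proof (cases "s = t")
      case False
      then have "norm (?g a) \<le> C * (t - s) powr \<alpha>" using C[of s t a a] st by auto
      then show ?thesis using le by (rule order_trans)
    qed simp
    show "norm (?g a - ?g b) \<le> ?c * norm (a - b) powr \<beta>"
    proof (cases "s = t")
      case False
      then have "norm (?g a - ?g b) \<le> C * (t - s) powr \<alpha> * norm (a - b) powr \<beta>" using C[of s t a b] st by auto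
      also have "\<dots> \<le> ?c * norm (a - b) powr \<beta>" using le by (intro mult_right_mono) auto
      finally show ?thesis .
    qed simp
    show "norm (?g a - ?g b) \<le> ?c * norm (a - b)"
    proof (cases "s = t")
      case False
      show ?thesis
      proof (rule differentiable_bound[of UNIV ?g "\<lambda>x v. DA t x v - DA s x v"])
        show "onorm (\<lambda>v. DA t x v - DA s x v) \<le> ?c" for x
        proof -
          have "onorm (\<lambda>v. DA t x v - DA s x v) \<le> C * (t - s) powr \<alpha>"
            using C[of s t x x] st False by auto
          then show ?thesis using le by (rule order_trans)
        qed
      qed (use deriv st in auto)
    qed simp
    show "norm (?g a - ?g b - (?g p - ?g q)) \<le> ?c * (norm ((a - p) - (b - q)) + norm (a - b) powr \<beta> * norm (b - q))"
    proof (cases "s = t")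
      case False
      show ?thesis
      proof (rule four_point_bound)
        show "(?g has_derivative (\<lambda>v. DA t x v - DA s x v)) (at x)" for x
          by (rule deriv) (use st in auto)
        show "onorm (\<lambda>v. DA t x v - DA s x v) \<le> ?c" for x
        proof -
          have "onorm (\<lambda>v. DA t x v - DA s x v) \<le> C * (t - s) powr \<alpha>"
            using C[of s t x x] st False by auto
          then show ?thesis using le by (rule order_trans)
        qed
        show "onorm (\<lambda>v. (DA t x v - DA s x v) - (DA t y v - DA s y v)) \<le> ?c * norm (x - y) powr \<beta>" for x y
        proof -
          have "onorm (\<lambda>v. (DA t x v - DA s x v) - (DA t y v - DA s y v)) \<le> C * (t - s) powr \<alpha> * norm (x - y) powr \<beta>"
            using C[of s t x y] st False by auto
          also have "\<dots> \<le> ?c * norm (x - y) powr \<beta>" using le by (intro mult_right_mono) auto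
          finally show ?thesis .
        qed
      qed
    qed simp
  qed
qed

text \<open>Makes the definite description in \<open>young_integral\<close> meaningful: one
  equidistant partition finer than both thresholds puts its sum within half the distance of both
  candidates.\<close>

lemma young_lim_unique:
  assumes t: "0 \<le> t" and I: "young_lim A x t I" and J: "young_lim A x t J"
  shows "I = J"
proof (rule ccontr)
  assume "I \<noteq> J"
  then have \<epsilon>: "0 < norm (I - J) / 2" by simp
  obtain \<eta>1 where \<eta>1: "\<eta>1 > 0" "\<And>p n. p 0 = 0 \<Longrightarrow> p n = t \<Longrightarrow> (\<And>i. i < n \<Longrightarrow> p i < p (Suc i) \<and> p (Suc i) - p i < \<eta>1) \<Longrightarrow>
     norm (young_sum A x p n - I) < norm (I - J) / 2"
    using I \<epsilon> unfolding young_lim_def by meson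
  obtain \<eta>2 where \<eta>2: "\<eta>2 > 0" "\<And>p n. p 0 = 0 \<Longrightarrow> p n = t \<Longrightarrow> (\<And>i. i < n \<Longrightarrow> p i < p (Suc i) \<and> p (Suc i) - p i < \<eta>2) \<Longrightarrow>
     norm (young_sum A x p n - J) < norm (I - J) / 2"
    using J \<epsilon> unfolding young_lim_def by meson
  obtain m :: nat where m: "t / min \<eta>1 \<eta>2 < real m" using reals_Archimedean2 by blast
  \<comment> \<open>Cells must have positive length, so for t = 0 the only partition is the one
    without cells.\<close>
  define n where "n = (if t = 0 then 0 else m)"
  define p where "p i = real i * (t / real m)" for i
  have n: "n > 0 \<Longrightarrow> t > 0 \<and> real m > 0" using t by (auto simp: n_def split: if_splits)
  have p0: "p 0 = 0" by (simp add: p_def)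
  have "t > 0 \<Longrightarrow> real m > 0" using m \<eta>1(1) \<eta>2(1) by (smt (verit) divide_pos_pos)
  then have pn: "p n = t" using t by (auto simp: p_def n_def)
  have step: "p i < p (Suc i) \<and> p (Suc i) - p i < min \<eta>1 \<eta>2" if "i < n" for i
  proof -
    have tm: "t > 0" "real m > 0" using n that by auto
    have "p (Suc i) - p i = t / real m" by (simp add: p_def algebra_simps add_divide_distrib)
    moreover have "0 < min \<eta>1 \<eta>2" using \<eta>1(1) \<eta>2(1) by simp
    then have "t / real m < min \<eta>1 \<eta>2"
      using m tm by (simp only: pos_divide_less_eq mult.commute)
    moreover have "0 < t / real m" using tm by simp
    ultimately show ?thesis by linarith
  qed
  have "norm (young_sum A x p n - I) < norm (I - J) / 2" by (rule \<eta>1(2)) (use p0 pn step in auto)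
  moreover have "norm (young_sum A x p n - J) < norm (I - J) / 2" by (rule \<eta>2(2)) (use p0 pn step in auto)
  moreover have "norm (I - J) \<le> norm (young_sum A x p n - J) + norm (young_sum A x p n - I)"
    using norm_triangle_ineq4[of "young_sum A x p n - J" "young_sum A x p n - I"] by simp
  ultimately show False by linarith
qed

text \<open>A superlinear error per cell forces convergence along every partition of small mesh,
  whichever partitions served to construct I.\<close>

lemma young_limI:
  fixes A :: "real \<Rightarrow> 'a \<Rightarrow> 'a::real_normed_vector"
  assumes I: "\<And>s t. 0 \<le> s \<Longrightarrow> s \<le> t \<Longrightarrow> t \<le> T \<Longrightarrow> norm (I t - I s - increment A s t (x s)) \<le> C * (t - s) powr \<theta>"
    and I0: "I 0 = 0" and C: "0 \<le> C" and \<theta>: "1 < \<theta>" and t: "0 \<le> t" "t \<le> T"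
  shows "young_lim A x t (I t)"
  unfolding young_lim_def
proof (intro allI impI)
  fix \<epsilon> :: real assume \<epsilon>: "0 < \<epsilon>"
  \<comment> \<open>Chosen so that C * t * r < \<epsilon>; the added 1 keeps the denominator
    positive and the inequality strict.\<close>
  define r where "r = \<epsilon> / (C * t + 1)"
  have r: "0 < r" using \<epsilon> C t by (auto simp: r_def intro!: divide_pos_pos add_nonneg_pos)
  define \<eta> where "\<eta> = r powr (1 / (\<theta> - 1))"
  have \<eta>: "0 < \<eta>" "\<eta> powr (\<theta> - 1) = r" using r \<theta> by (auto simp: \<eta>_def powr_powr)
  show "\<exists>\<eta>>0. \<forall>p n. p 0 = 0 \<and> p n = t \<and> (\<forall>i<n. p i < p (Suc i) \<and> p (Suc i) - p i < \<eta>) \<longrightarrow>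
      norm (young_sum A x p n - I t) < \<epsilon>"
  proof (intro exI[of _ \<eta>] conjI allI impI)
    fix p n assume p: "p 0 = 0 \<and> p n = t \<and> (\<forall>i<n. p i < p (Suc i) \<and> p (Suc i) - p i < \<eta>)"
    have "norm ((\<Sum>i<n. increment A (p i) (p (Suc i)) (x (p i))) - (I (p n) - I (p 0))) \<le> C * \<eta> powr (\<theta> - 1) * (p n - p 0)"
      by (rule sewing_error_bound[where \<Gamma> = "\<lambda>s t. increment A s t (x s)", OF I C \<theta>]) (use p t in \<open>auto simp: less_imp_le\<close>)
    then have "norm (young_sum A x p n - I t) \<le> C * t * r"
      using p I0 \<eta>(2) by (simp add: young_sum_def mult_ac)
    also have "\<dots> < (C * t + 1) * r" using r by (simp add: algebra_simps)
    also have "\<dots> = \<epsilon>" using C t by (simp add: r_def add_nonneg_eq_0_iff)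
    finally show "norm (young_sum A x p n - I t) < \<epsilon>" .
  qed (use \<eta> in auto)
qed

section \<open>The Young integral along \<gamma>-Hoelder paths: size and stability\<close>

locale fractional_yde =
  fixes A :: "real \<Rightarrow> 'a::euclidean_space \<Rightarrow> 'a" and \<delta> \<alpha> \<beta> \<gamma> T C :: real
  assumes T: "0 < T" and \<delta>: "0 < \<delta>" "\<delta> < 1" and \<alpha>: "0 < \<alpha>" "\<alpha> < 1" and \<beta>: "0 < \<beta>" "\<beta> < 1"
    and \<gamma>: "0 < \<gamma>" "\<gamma> < \<alpha> + \<delta> - 1" and \<theta>: "1 < \<alpha> + \<beta> * \<gamma>"
    and C: "0 \<le> C"
    and A_bound: "\<And>s t x. 0 \<le> s \<Longrightarrow> s \<le> t \<Longrightarrow> t \<le> T \<Longrightarrow> norm (increment A s t x) \<le> C * (t - s) powr \<alpha>"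
    and A_holder: "\<And>s t x y. 0 \<le> s \<Longrightarrow> s \<le> t \<Longrightarrow> t \<le> T \<Longrightarrow>
       norm (increment A s t x - increment A s t y) \<le> C * (t - s) powr \<alpha> * norm (x - y) powr \<beta>"
    and A_lipschitz: "\<And>s t x y. 0 \<le> s \<Longrightarrow> s \<le> t \<Longrightarrow> t \<le> T \<Longrightarrow>
       norm (increment A s t x - increment A s t y) \<le> C * (t - s) powr \<alpha> * norm (x - y)"
    and A_four_point: "\<And>s t a b p q. 0 \<le> s \<Longrightarrow> s \<le> t \<Longrightarrow> t \<le> T \<Longrightarrow>
       norm (increment A s t a - increment A s t b - (increment A s t p - increment A s t q))
         \<le> C * (t - s) powr \<alpha> * (norm ((a - p) - (b - q)) + norm (a - b) powr \<beta> * norm (b - q))"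
begin

abbreviation "\<theta>' \<equiv> \<alpha> + \<beta> * \<gamma>"

lemma holder_path_powr:
  assumes x: "holder_bound R \<gamma> T x" and st: "0 \<le> s" "s \<le> u" "u \<le> t" "t \<le> T"
  shows "norm (x s - x u) powr \<beta> \<le> R powr \<beta> * (t - s) powr (\<beta> * \<gamma>)"
proof -
  have R: "0 \<le> R" by (rule holder_bound_nonneg[OF x])
  have "norm (x u - x s) \<le> R * (u - s) powr \<gamma>" by (rule holder_boundD[OF x]) (use st in auto)
  also have "\<dots> \<le> R * (t - s) powr \<gamma>" using R st \<gamma> by (intro mult_left_mono powr_mono2) auto
  finally have "norm (x s - x u) powr \<beta> \<le> (R * (t - s) powr \<gamma>) powr \<beta>"
    using \<beta> by (intro powr_mono2) (auto simp: norm_minus_commute)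
  also have "\<dots> = R powr \<beta> * (t - s) powr (\<beta> * \<gamma>)"
    using R by (simp add: powr_mult powr_powr mult.commute)
  finally show ?thesis .
qed

text \<open>As A_{s,t} = A_{s,u} + A_{u,t}, the defect is A_{u,t} at x_s minus A_{u,t} at x_u. The
  \<beta>-Hoelder bound is taken here in preference to the Lipschitz one: it produces R powr
  \<beta>, the sublinear power that later closes the ball.\<close>

lemma almost_additive_germ:
  assumes x: "holder_bound R \<gamma> T x"
  shows "almost_additive (C * R powr \<beta>) \<theta>' T (\<lambda>s t. increment A s t (x s))"
  unfolding almost_additive_def
proof (intro conjI allI impI)
  show "0 \<le> C * R powr \<beta>" using C by simp
  fix s u t assume st: "0 \<le> s \<and> s \<le> u \<and> u \<le> t \<and> t \<le> T"
  have "increment A s t (x s) - increment A s u (x s) - increment A u t (x u) = increment A u t (x s) - increment A u t (x u)"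
    by simp
  also have "norm \<dots> \<le> C * (t - u) powr \<alpha> * norm (x s - x u) powr \<beta>"
    by (rule A_holder) (use st in auto)
  also have "\<dots> \<le> C * (t - s) powr \<alpha> * (R powr \<beta> * (t - s) powr (\<beta> * \<gamma>))"
    using C st \<alpha> by (intro mult_mono mult_left_mono powr_mono2 holder_path_powr[OF x]) auto
  also have "\<dots> = C * R powr \<beta> * (t - s) powr \<theta>'" by (simp add: powr_add)
  finally show "norm (increment A s t (x s) - increment A s u (x s) - increment A u t (x u)) \<le> C * R powr \<beta> * (t - s) powr \<theta>'" .
qed

lemma young_integral:
  assumes x: "holder_bound R \<gamma> T x"
  shows young_integral_lim: "t \<in> {0..T} \<Longrightarrow> young_lim A x t (young_integral A x t)"
    and young_integral_germ: "0 \<le> s \<Longrightarrow> s \<le> t \<Longrightarrow> t \<le> T \<Longrightarrow>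
      norm (young_integral A x t - young_integral A x s - increment A s t (x s)) \<le> sewing_const \<theta>' * (C * R powr \<beta>) * (t - s) powr \<theta>'"
proof -
  obtain I where I0: "I 0 = 0" and I: "\<And>s t. 0 \<le> s \<Longrightarrow> s \<le> t \<Longrightarrow> t \<le> T \<Longrightarrow>
      norm (I t - I s - increment A s t (x s)) \<le> sewing_const \<theta>' * (C * R powr \<beta>) * (t - s) powr \<theta>'"
    by (rule sewing_lemma[OF almost_additive_germ[OF x] \<theta> T]) (rule that)
  have "0 \<le> sewing_const \<theta>' * (C * R powr \<beta>)" using sewing_const(1)[OF \<theta>] C by simp
  then have lim: "young_lim A x t (I t)" if "t \<in> {0..T}" for t
    by (intro young_limI[OF I I0 _ \<theta>]) (use that in auto)
  have eq: "young_integral A x t = I t" if "t \<in> {0..T}" for t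
    unfolding young_integral_def using lim[OF that] young_lim_unique that by (intro the_equality) auto
  show "young_lim A x t (young_integral A x t)" if "t \<in> {0..T}" using lim eq that by simp
  show "norm (young_integral A x t - young_integral A x s - increment A s t (x s)) \<le> sewing_const \<theta>' * (C * R powr \<beta>) * (t - s) powr \<theta>'"
    if "0 \<le> s" "s \<le> t" "t \<le> T" using I[OF that] eq[of s] eq[of t] that by simp
qed

lemma young_integral_holder_bound:
  assumes x: "holder_bound R \<gamma> T x"
  shows "holder_bound (C + sewing_const \<theta>' * (C * R powr \<beta>) * T powr (\<beta> * \<gamma>)) \<alpha> T (young_integral A x)"
proof (rule holder_boundI)
  let ?S = "sewing_const \<theta>' * (C * R powr \<beta>)"
  have S: "0 \<le> ?S" using sewing_const(1)[OF \<theta>] C by simp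
  then show "0 \<le> C + ?S * T powr (\<beta> * \<gamma>)" using C by simp
  fix s t assume st: "0 \<le> s" "s \<le> t" "t \<le> T"
  let ?Y = "young_integral A x"
  have "norm (?Y t - ?Y s) \<le> norm (increment A s t (x s)) + norm (?Y t - ?Y s - increment A s t (x s))"
    using norm_triangle_ineq[of "increment A s t (x s)" "?Y t - ?Y s - increment A s t (x s)"] by simp
  also have "\<dots> \<le> C * (t - s) powr \<alpha> + ?S * (t - s) powr \<theta>'"
    by (intro add_mono A_bound young_integral_germ[OF x] st)
  also have "(t - s) powr \<theta>' = (t - s) powr (\<beta> * \<gamma>) * (t - s) powr \<alpha>" by (simp add: powr_add)
  also have "?S * \<dots> \<le> ?S * (T powr (\<beta> * \<gamma>) * (t - s) powr \<alpha>)"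
    using S st \<beta> \<gamma> by (intro mult_left_mono mult_right_mono powr_mono2) auto
  finally show "norm (?Y t - ?Y s) \<le> (C + ?S * T powr (\<beta> * \<gamma>)) * (t - s) powr \<alpha>"
    by (simp add: algebra_simps)
qed

text \<open>C * T powr \<gamma> is the Lipschitz bound of the germ, for x - y starting at 0. In the
  sewing remainder, T powr (\<gamma> - \<beta> * \<gamma>) is the price of lowering the increment of
  x - y from exponent \<gamma> to \<beta> * \<gamma>, and R powr \<beta> * T powr \<gamma> is the
  product term of the four point bound. All powers are of T, so one constant serves every
  \<tau>.\<close>

definition young_stability_const :: "real \<Rightarrow> real" where
  "young_stability_const R =
     C * T powr \<gamma> + sewing_const \<theta>' * (C * (T powr (\<gamma> - \<beta> * \<gamma>) + R powr \<beta> * T powr \<gamma>)) * T powr (\<beta> * \<gamma>)"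

text \<open>The difference of the two germs is treated as a germ of its own; the four point bound at
  x s, x u, y s, y u makes its defect linear in V. The distance is controlled only up to \<tau>,
  because the weighted seminorm will ask for every initial interval separately.\<close>

lemma young_integral_stability:
  assumes x: "holder_bound R \<gamma> T x" and y: "holder_bound R \<gamma> T y"
    and v: "holder_bound V \<gamma> \<tau> (\<lambda>t. x t - y t)" and xy: "x 0 = y 0" and \<tau>: "\<tau> \<le> T"
  shows "holder_bound (young_stability_const R * V) \<alpha> \<tau> (\<lambda>t. young_integral A x t - young_integral A y t)"
proof -
  let ?\<Gamma> = "\<lambda>s t. increment A s t (x s) - increment A s t (y s)"
  let ?J = "\<lambda>t. young_integral A x t - young_integral A y t"
  let ?B = "C * (T powr (\<gamma> - \<beta> * \<gamma>) + R powr \<beta> * T powr \<gamma>)"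
  have V: "0 \<le> V" by (rule holder_bound_nonneg[OF v])
  have B: "0 \<le> ?B" using C by simp
  have S: "0 < sewing_const \<theta>'" by (rule sewing_const(1)[OF \<theta>])
  have v_le: "norm (x u - y u) \<le> V * T powr \<gamma>" if "0 \<le> u" "u \<le> \<tau>" for u
  proof -
    have "norm ((x u - y u) - (x 0 - y 0)) \<le> V * (u - 0) powr \<gamma>" by (rule holder_boundD[OF v]) (use that in auto)
    also have "\<dots> \<le> V * T powr \<gamma>" using V that \<tau> \<gamma> by (intro mult_left_mono powr_mono2) auto
    finally show ?thesis by (simp add: xy)
  qed
  have \<Gamma>: "almost_additive (?B * V) \<theta>' \<tau> ?\<Gamma>"
    unfolding almost_additive_def
  proof (intro conjI allI impI)
    show "0 \<le> ?B * V" using B V by simp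
    fix s u t assume st: "0 \<le> s \<and> s \<le> u \<and> u \<le> t \<and> t \<le> \<tau>"
    have "norm ((x u - y u) - (x s - y s)) \<le> V * (u - s) powr \<gamma>" by (rule holder_boundD[OF v]) (use st in auto)
    also have "\<dots> \<le> V * (t - s) powr \<gamma>" using st V \<gamma> by (intro mult_left_mono powr_mono2) auto
    also have "(t - s) powr \<gamma> = (t - s) powr (\<gamma> - \<beta> * \<gamma>) * (t - s) powr (\<beta> * \<gamma>)" by (simp add: powr_add[symmetric])
    also have "V * \<dots> \<le> V * (T powr (\<gamma> - \<beta> * \<gamma>) * (t - s) powr (\<beta> * \<gamma>))"
      using st V \<gamma> \<beta> \<tau> by (intro mult_left_mono mult_right_mono powr_mono2) auto
    finally have 1: "norm ((x s - y s) - (x u - y u)) \<le> V * (T powr (\<gamma> - \<beta> * \<gamma>) * (t - s) powr (\<beta> * \<gamma>))"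
      by (simp add: norm_minus_commute)
    have 2: "norm (x s - x u) powr \<beta> * norm (x u - y u) \<le> (R powr \<beta> * (t - s) powr (\<beta> * \<gamma>)) * (V * T powr \<gamma>)"
      using st \<tau> V by (intro mult_mono v_le holder_path_powr[OF x]) auto
    have "?\<Gamma> s t - ?\<Gamma> s u - ?\<Gamma> u t
        = increment A u t (x s) - increment A u t (x u) - (increment A u t (y s) - increment A u t (y u))" by simp
    also have "norm \<dots> \<le> C * (t - u) powr \<alpha> * (norm ((x s - y s) - (x u - y u)) + norm (x s - x u) powr \<beta> * norm (x u - y u))"
      by (rule A_four_point) (use st \<tau> in auto)
    also have "\<dots> \<le> C * (t - s) powr \<alpha> * (V * (T powr (\<gamma> - \<beta> * \<gamma>) * (t - s) powr (\<beta> * \<gamma>)) + (R powr \<beta> * (t - s) powr (\<beta> * \<gamma>)) * (V * T powr \<gamma>))"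
      by (rule mult_mono[OF _ add_mono[OF 1 2]]) (use C st \<alpha> in \<open>auto intro!: mult_left_mono powr_mono2\<close>)
    also have "\<dots> = ?B * V * (t - s) powr \<theta>'" by (simp add: powr_add algebra_simps)
    finally show "norm (?\<Gamma> s t - ?\<Gamma> s u - ?\<Gamma> u t) \<le> ?B * V * (t - s) powr \<theta>'" .
  qed
  show ?thesis
  proof (rule holder_boundI)
    have "0 \<le> young_stability_const R" unfolding young_stability_const_def using C B S
      by (intro add_nonneg_nonneg mult_nonneg_nonneg) auto
    then show "0 \<le> young_stability_const R * V" using V by simp
    fix s t assume st: "0 \<le> s" "s \<le> t" "t \<le> \<tau>"
    \<comment> \<open>This crude bound, from the two integrals separately, does not shrink with V.
      It only qualifies the pair for \<open>sewing_estimate\<close>, which exchanges its constant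
      for one proportional to V.\<close>
    have germ: "norm (?J t - ?J s - ?\<Gamma> s t) \<le> 2 * (sewing_const \<theta>' * (C * R powr \<beta>)) * (t - s) powr \<theta>'"
      if "0 \<le> s" "s \<le> t" "t \<le> \<tau>" for s t
    proof -
      let ?a = "young_integral A x t - young_integral A x s - increment A s t (x s)"
      let ?b = "young_integral A y t - young_integral A y s - increment A s t (y s)"
      have "?J t - ?J s - ?\<Gamma> s t = ?a - ?b" by simp
      then have "norm (?J t - ?J s - ?\<Gamma> s t) \<le> norm ?a + norm ?b" by (metis norm_triangle_ineq4)
      then show ?thesis
        using young_integral_germ[OF x that(1,2)] young_integral_germ[OF y that(1,2)] that \<tau> by linarith
    qed
    have 1: "norm (?J t - ?J s - ?\<Gamma> s t) \<le> sewing_const \<theta>' * (?B * V) * (t - s) powr \<theta>'"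
      by (rule sewing_estimate[OF \<Gamma> \<theta> germ]) (use S C st in auto)
    have "norm (?\<Gamma> s t) \<le> C * (t - s) powr \<alpha> * norm (x s - y s)"
      by (rule A_lipschitz) (use st \<tau> in auto)
    also have "\<dots> \<le> C * (t - s) powr \<alpha> * (V * T powr \<gamma>)"
      using C v_le[of s] st by (intro mult_left_mono) auto
    finally have 2: "norm (?\<Gamma> s t) \<le> C * (t - s) powr \<alpha> * (V * T powr \<gamma>)" .
    have "norm (?J t - ?J s) \<le> norm (?\<Gamma> s t) + norm (?J t - ?J s - ?\<Gamma> s t)"
      using norm_triangle_ineq[of "?\<Gamma> s t" "?J t - ?J s - ?\<Gamma> s t"] by simp
    also have "\<dots> \<le> C * (t - s) powr \<alpha> * (V * T powr \<gamma>) + sewing_const \<theta>' * (?B * V) * (t - s) powr \<theta>'"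
      using 1 2 by (rule add_mono[rotated])
    also have "(t - s) powr \<theta>' = (t - s) powr (\<beta> * \<gamma>) * (t - s) powr \<alpha>" by (simp add: powr_add)
    also have "sewing_const \<theta>' * (?B * V) * \<dots> \<le> sewing_const \<theta>' * (?B * V) * (T powr (\<beta> * \<gamma>) * (t - s) powr \<alpha>)"
      using S B V st \<beta> \<gamma> \<tau> by (intro mult_left_mono mult_right_mono powr_mono2) auto
    also have "C * (t - s) powr \<alpha> * (V * T powr \<gamma>) + sewing_const \<theta>' * (?B * V) * (T powr (\<beta> * \<gamma>) * (t - s) powr \<alpha>)
        = young_stability_const R * V * (t - s) powr \<alpha>"
      unfolding young_stability_const_def by (simp only: distrib_left distrib_right mult_ac)
    finally show "norm (?J t - ?J s) \<le> young_stability_const R * V * (t - s) powr \<alpha>" by simp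
  qed
qed

end

section \<open>The fixed point argument\<close>

text \<open>A Bielecki type seminorm on increments. The weight is taken at the later time t, so for
  \<nu> \<ge> 0 it is at most exp (\<nu> * \<tau>) on [0, \<tau>], and causal operators can be
  estimated there by their unweighted bounds.\<close>

definition weighted_bound :: "real \<Rightarrow> real \<Rightarrow> real \<Rightarrow> real \<Rightarrow> (real \<Rightarrow> 'a::real_normed_vector) \<Rightarrow> bool" where
  "weighted_bound N \<nu> a T v \<longleftrightarrow> 0 \<le> N \<and>
     (\<forall>s t. 0 \<le> s \<and> s \<le> t \<and> t \<le> T \<longrightarrow> norm (v t - v s) \<le> N * exp (\<nu> * t) * (t - s) powr a)"

lemma weighted_boundI:
  assumes "0 \<le> N" "\<And>s t. 0 \<le> s \<Longrightarrow> s \<le> t \<Longrightarrow> t \<le> T \<Longrightarrow> norm (v t - v s) \<le> N * exp (\<nu> * t) * (t - s) powr a"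
  shows "weighted_bound N \<nu> a T v"
  using assms unfolding weighted_bound_def by auto

lemma weighted_boundD:
  assumes "weighted_bound N \<nu> a T v" "0 \<le> s" "s \<le> t" "t \<le> T"
  shows "norm (v t - v s) \<le> N * exp (\<nu> * t) * (t - s) powr a"
  using assms unfolding weighted_bound_def by auto

lemma weighted_bound_nonneg: "weighted_bound N \<nu> a T v \<Longrightarrow> 0 \<le> N"
  by (simp add: weighted_bound_def)

lemma weighted_bound_cong:
  assumes "\<And>t. t \<in> {0..T} \<Longrightarrow> v t = w t"
  shows "weighted_bound N \<nu> a T v \<longleftrightarrow> weighted_bound N \<nu> a T w"
  using assms unfolding weighted_bound_def by auto

lemma holder_bound_imp_weighted_bound:
  assumes "holder_bound N a T v" "0 \<le> \<nu>"
  shows "weighted_bound N \<nu> a T v"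
proof (rule weighted_boundI)
  show N: "0 \<le> N" by (rule holder_bound_nonneg[OF assms(1)])
  fix s t assume st: "0 \<le> s" "s \<le> t" "t \<le> T"
  have "norm (v t - v s) \<le> N * 1 * (t - s) powr a" using holder_boundD[OF assms(1) st] by simp
  also have "\<dots> \<le> N * exp (\<nu> * t) * (t - s) powr a"
    using N st assms(2) by (intro mult_right_mono mult_left_mono) auto
  finally show "norm (v t - v s) \<le> N * exp (\<nu> * t) * (t - s) powr a" .
qed

lemma weighted_bound_imp_holder_bound:
  assumes v: "weighted_bound N \<nu> a T v" and "0 \<le> \<nu>" "\<tau> \<le> T"
  shows "holder_bound (N * exp (\<nu> * \<tau>)) a \<tau> v"
proof (rule holder_boundI)
  note N = weighted_bound_nonneg[OF v]
  show "0 \<le> N * exp (\<nu> * \<tau>)" using N by simp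
  fix s t assume st: "0 \<le> s" "s \<le> t" "t \<le> \<tau>"
  have "norm (v t - v s) \<le> N * exp (\<nu> * t) * (t - s) powr a" by (rule weighted_boundD[OF v]) (use st assms in auto)
  also have "\<dots> \<le> N * exp (\<nu> * \<tau>) * (t - s) powr a"
    using N st assms(2) by (intro mult_right_mono mult_left_mono) (auto intro: mult_left_mono)
  finally show "norm (v t - v s) \<le> N * exp (\<nu> * \<tau>) * (t - s) powr a" .
qed

lemma weighted_bound_add:
  assumes v: "weighted_bound N \<nu> a T v" and w: "weighted_bound M \<nu> a T w"
  shows "weighted_bound (N + M) \<nu> a T (\<lambda>t. v t + w t)"
proof (rule weighted_boundI)
  show "0 \<le> N + M" using weighted_bound_nonneg[OF v] weighted_bound_nonneg[OF w] by simp
  fix s t assume st: "0 \<le> s" "s \<le> t" "t \<le> T"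
  have "v t + w t - (v s + w s) = (v t - v s) + (w t - w s)" by simp
  then have "norm (v t + w t - (v s + w s)) \<le> norm (v t - v s) + norm (w t - w s)"
    by (metis norm_triangle_ineq)
  also have "\<dots> \<le> N * exp (\<nu> * t) * (t - s) powr a + M * exp (\<nu> * t) * (t - s) powr a"
    by (intro add_mono weighted_boundD[OF v] weighted_boundD[OF w] st)
  finally show "norm (v t + w t - (v s + w s)) \<le> (N + M) * exp (\<nu> * t) * (t - s) powr a"
    by (simp add: algebra_simps)
qed

text \<open>The exponential weight makes an increment over a long interval at most twice the largest
  admissible increment over its last stretch of length \<open>1 / \<nu>\<close>. Giving up some of the exponent
  therefore gains a negative power of \<open>\<nu>\<close>, also for the non-local operator \<open>\<Xi>\<close>.\<close>

lemma weighted_bound_gain: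
  assumes v: "weighted_bound Q \<nu> a T v" and \<nu>: "0 < \<nu>" and b: "0 \<le> b" "b \<le> a"
  shows "weighted_bound (2 * Q * (1 / \<nu>) powr (a - b)) \<nu> b T v"
proof (rule weighted_boundI)
  note Q = weighted_bound_nonneg[OF v]
  define h where "h = 1 / \<nu>"
  have h: "0 < h" "\<nu> * h = 1" using \<nu> by (auto simp: h_def)
  show "0 \<le> 2 * Q * (1 / \<nu>) powr (a - b)" using Q by simp
  have short: "norm (v t - v s) \<le> Q * exp (\<nu> * t) * h powr a"
    if "0 \<le> s" "s \<le> t" "t \<le> T" "t - s \<le> h" for s t
  proof -
    have "norm (v t - v s) \<le> Q * exp (\<nu> * t) * (t - s) powr a" by (rule weighted_boundD[OF v]) (use that in auto)
    also have "\<dots> \<le> Q * exp (\<nu> * t) * h powr a" using that Q b by (intro mult_left_mono powr_mono2) auto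
    finally show ?thesis .
  qed
  \<comment> \<open>Induction over stretches of length h, peeling off the last one: as \<nu> * h =
    1, the weight of the rest drops by the factor exp (- 1), and Q + 2 * Q * exp (- 1) is at most 2
    * Q. The number n of stretches does not enter the bound.\<close>
  have long: "norm (v t - v s) \<le> 2 * Q * exp (\<nu> * t) * h powr a"
    if "0 \<le> s" "s \<le> t" "t \<le> T" "t - s \<le> real n * h" for n s t
    using that
  proof (induction n arbitrary: t)
    case 0
    then have "s = t" by simp
    then show ?case using Q by simp
  next
    case (Suc n)
    have pos: "0 \<le> Q * exp (\<nu> * t) * h powr a" using Q by simp
    show ?case
    proof (cases "t - s \<le> h")
      case True
      then show ?thesis using short[of s t] Suc.prems pos by simp
    next
      case False
      have "norm (v (t - h) - v s) \<le> 2 * Q * exp (\<nu> * (t - h)) * h powr a"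
        by (rule Suc.IH) (use Suc.prems False h in \<open>auto simp: algebra_simps\<close>)
      also have "exp (\<nu> * (t - h)) = exp (\<nu> * t) * exp (- 1)"
        using h by (simp add: exp_add[symmetric] right_diff_distrib)
      also have "2 * Q * (exp (\<nu> * t) * exp (- 1)) * h powr a = (Q * exp (\<nu> * t) * h powr a) * (2 * exp (- 1))"
        by simp
      also have "\<dots> \<le> (Q * exp (\<nu> * t) * h powr a) * 1"
        using exp_ge_add_one_self[of 1] by (intro mult_left_mono pos) (simp add: exp_minus field_simps)
      finally have "norm (v (t - h) - v s) \<le> Q * exp (\<nu> * t) * h powr a" by simp
      moreover have "norm (v t - v (t - h)) \<le> Q * exp (\<nu> * t) * h powr a"
        by (rule short) (use Suc.prems False h in auto)
      moreover have "norm (v t - v s) \<le> norm (v t - v (t - h)) + norm (v (t - h) - v s)"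
        using norm_triangle_ineq[of "v t - v (t - h)" "v (t - h) - v s"] by simp
      ultimately show ?thesis by simp
    qed
  qed
  fix s t assume st: "0 \<le> s" "s \<le> t" "t \<le> T"
  have "norm (v t - v s) \<le> 2 * Q * exp (\<nu> * t) * (h powr (a - b) * (t - s) powr b)"
  proof (cases "t - s \<le> h")
    case True
    have "norm (v t - v s) \<le> Q * exp (\<nu> * t) * (t - s) powr a" by (rule weighted_boundD[OF v st])
    also have "(t - s) powr a = (t - s) powr (a - b) * (t - s) powr b" by (simp add: powr_add[symmetric])
    also have "Q * exp (\<nu> * t) * \<dots> \<le> 2 * Q * exp (\<nu> * t) * (h powr (a - b) * (t - s) powr b)"
      using True st Q b by (intro mult_mono powr_mono2 mult_right_mono) auto
    finally show ?thesis .
  next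
    case False
    obtain n :: nat where "(t - s) / h < real n" using reals_Archimedean2 by blast
    then have "norm (v t - v s) \<le> 2 * Q * exp (\<nu> * t) * h powr a"
      using h by (intro long[of s t n] st) (simp add: field_simps)
    also have "h powr a = h powr (a - b) * h powr b" by (simp add: powr_add[symmetric])
    also have "2 * Q * exp (\<nu> * t) * \<dots> \<le> 2 * Q * exp (\<nu> * t) * (h powr (a - b) * (t - s) powr b)"
      using False st Q b h by (intro mult_left_mono powr_mono2) auto
    finally show ?thesis .
  qed
  then show "norm (v t - v s) \<le> 2 * Q * (1 / \<nu>) powr (a - b) * exp (\<nu> * t) * (t - s) powr b"
    by (simp add: h_def mult_ac)
qed

section \<open>The Picard map: invariance, contraction, fixed point\<close>

context fractional_yde
begin

definition picard :: "'a \<Rightarrow> (real \<Rightarrow> 'a) \<Rightarrow> real \<Rightarrow> 'a" where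
  "picard x0 x t = x0 + marchaud \<delta> (young_integral A x) t"

lemma picard_0: "picard x0 x 0 = x0"
  by (simp add: picard_def marchaud_0)

text \<open>For a \<gamma>-Hoelder path the Young limits exist and the integral is \<alpha>-Hoelder
  with \<alpha> > 1 - \<delta>, so only the equation is left, and there \<Xi> takes its Marchaud
  form.\<close>

lemma is_solution_iff:
  assumes x: "holder_bound R \<gamma> T x"
  shows "is_solution \<delta> T A x0 x \<longleftrightarrow> (\<forall>t\<in>{0..T}. x t = picard x0 x t)"
proof -
  note Y = young_integral_holder_bound[OF x]
  have "1 - \<delta> < \<alpha>" using \<gamma> by simp
  then have "\<exists>\<alpha>'>1 - \<delta>. holder \<alpha>' T (young_integral A x)"
    using Y holder_iff_holder_bound by blast
  moreover have "Xi \<delta> T (young_integral A x) t = marchaud \<delta> (young_integral A x) t" if "t \<in> {0..T}" for t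
    by (rule Xi_eq_marchaud[OF \<delta> T _ \<alpha>(2) Y that]) (use \<gamma> in auto)
  moreover have "\<forall>t\<in>{0..T}. \<exists>I. young_lim A x t I" using young_integral_lim[OF x] by blast
  ultimately show ?thesis unfolding is_solution_def picard_def by auto
qed

lemma ex_invariant_radius:
  obtains R where "0 < R" "\<And>x x0. holder_bound R \<gamma> T x \<Longrightarrow> holder_bound R \<gamma> T (picard x0 x)"
proof -
  define k where "k = marchaud_const \<delta> (\<gamma> + 1 - \<delta>) * T powr (\<alpha> - (\<gamma> + 1 - \<delta>)) * C"
  define l where "l = sewing_const \<theta>' * T powr (\<beta> * \<gamma>)"
  have mc: "0 < marchaud_const \<delta> (\<gamma> + 1 - \<delta>)" using \<delta> \<gamma> by (intro marchaud_const_pos) auto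
  have k: "0 \<le> k" using mc C by (simp add: k_def)
  have l: "0 \<le> l" using sewing_const(1)[OF \<theta>] by (simp add: l_def)
  \<comment> \<open>The map sends the Hoelder constant R to k * (1 + l * R powr \<beta>). For R
    \<ge> 1 this is at most k * (1 + l) * R powr \<beta>, hence at most R once R powr (1 - \<beta>)
    reaches k * (1 + l).\<close>
  define R where "R = max 1 ((k * (1 + l)) powr (1 / (1 - \<beta>)))"
  have R: "1 \<le> R" by (simp add: R_def)
  have "k * (1 + l) = ((k * (1 + l)) powr (1 / (1 - \<beta>))) powr (1 - \<beta>)"
    using k l \<beta> by (simp add: powr_powr)
  also have "\<dots> \<le> R powr (1 - \<beta>)" unfolding R_def using \<beta> by (intro powr_mono2) auto
  finally have kl: "k * (1 + l) \<le> R powr (1 - \<beta>)" .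
  have "1 \<le> R powr \<beta>" using R \<beta> by (simp add: ge_one_powr_ge_zero)
  then have "k * (1 + l * R powr \<beta>) \<le> k * (R powr \<beta> + l * R powr \<beta>)"
    using k by (intro mult_left_mono add_right_mono) auto
  also have "\<dots> = k * (1 + l) * R powr \<beta>" by (simp add: algebra_simps)
  also have "\<dots> \<le> R powr (1 - \<beta>) * R powr \<beta>" using kl by (intro mult_right_mono) auto
  also have "\<dots> = R" using R by (simp add: powr_add[symmetric])
  finally have le: "k * (1 + l * R powr \<beta>) \<le> R" .
  show thesis
  proof
    show "0 < R" using R by simp
    fix x :: "real \<Rightarrow> 'a" and x0 assume x: "holder_bound R \<gamma> T x"
    have "holder_bound ((C + sewing_const \<theta>' * (C * R powr \<beta>) * T powr (\<beta> * \<gamma>)) * T powr (\<alpha> - (\<gamma> + 1 - \<delta>)))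
        (\<gamma> + 1 - \<delta>) T (young_integral A x)"
      by (rule holder_bound_weaken[OF young_integral_holder_bound[OF x]]) (use \<gamma> T in auto)
    from marchaud_holder_bound[OF this \<delta>]
    have "holder_bound (marchaud_const \<delta> (\<gamma> + 1 - \<delta>) * ((C + sewing_const \<theta>' * (C * R powr \<beta>) * T powr (\<beta> * \<gamma>)) * T powr (\<alpha> - (\<gamma> + 1 - \<delta>))))
        \<gamma> T (marchaud \<delta> (young_integral A x))"
      using \<gamma> by simp
    moreover have "marchaud_const \<delta> (\<gamma> + 1 - \<delta>) * ((C + sewing_const \<theta>' * (C * R powr \<beta>) * T powr (\<beta> * \<gamma>)) * T powr (\<alpha> - (\<gamma> + 1 - \<delta>)))
       = k * (1 + l * R powr \<beta>)"
      by (simp add: k_def l_def algebra_simps)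
    ultimately have "holder_bound R \<gamma> T (marchaud \<delta> (young_integral A x))"
      using le by (auto intro: holder_bound_mono)
    then show "holder_bound R \<gamma> T (picard x0 x)" by (simp add: holder_bound_def picard_def)
  qed
qed

text \<open>The chain of exponents: the Young integral leads from \<gamma> to \<alpha>, the weight
  gains its small factor on the way down to a = \<gamma> + 1 - \<delta>, and the Marchaud shift
  returns to \<gamma>. Equal starting values let the seminorm, which sees increments only, control
  the values that enter the Young integral.\<close>

lemma ex_contraction_weight:
  assumes "0 < R"
  obtains \<nu> where "0 < \<nu>"
    "\<And>x y x0 N. holder_bound R \<gamma> T x \<Longrightarrow> holder_bound R \<gamma> T y \<Longrightarrow> x 0 = y 0 \<Longrightarrow>
       weighted_bound N \<nu> \<gamma> T (\<lambda>t. x t - y t) \<Longrightarrow>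
       weighted_bound (N / 2) \<nu> \<gamma> T (\<lambda>t. picard x0 x t - picard x0 y t)"
proof -
  define a where "a = \<gamma> + 1 - \<delta>"
  have a: "0 < a" "a < \<alpha>" "a + \<delta> > 1" "a + \<delta> - 1 = \<gamma>" using \<gamma> \<delta> by (auto simp: a_def)
  let ?M = "young_stability_const R" and ?m = "marchaud_const \<delta> a"
  have m: "0 < ?m" using \<delta> a by (intro marchaud_const_pos) auto
  have M: "0 \<le> ?M"
    unfolding young_stability_const_def using C sewing_const(1)[OF \<theta>]
    by (intro add_nonneg_nonneg mult_nonneg_nonneg) auto
  \<comment> \<open>The gained factor will be 1 / q, and 2 * ?m * ?M / q is at most 1 / 2. The added
    1 keeps q, and with it \<nu>, positive even if ?M = 0.\<close>
  define q where "q = 4 * ?m * ?M + 1"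
  have q: "1 \<le> q" using m M by (simp add: q_def)
  define \<nu> where "\<nu> = q powr (1 / (\<alpha> - a))"
  have \<nu>: "0 < \<nu>" using q by (simp add: \<nu>_def)
  have inv_q: "(1 / \<nu>) powr (\<alpha> - a) = 1 / q"
    using q a by (simp add: \<nu>_def powr_divide powr_powr)
  have gain: "?m * (2 * ?M * (1 / \<nu>) powr (\<alpha> - a)) \<le> 1 / 2"
  proof -
    have "?m * (2 * ?M) \<le> q / 2" by (simp add: q_def)
    then have "?m * (2 * ?M) / q \<le> 1 / 2" using q by (simp add: divide_simps)
    then show ?thesis by (simp add: inv_q)
  qed
  show thesis
  proof
    fix x y :: "real \<Rightarrow> 'a" and x0 N
    assume x: "holder_bound R \<gamma> T x" and y: "holder_bound R \<gamma> T y" and xy: "x 0 = y 0"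
      and v: "weighted_bound N \<nu> \<gamma> T (\<lambda>t. x t - y t)"
    note N = weighted_bound_nonneg[OF v]
    let ?J = "\<lambda>t. young_integral A x t - young_integral A y t"
    have "weighted_bound (?M * N) \<nu> \<alpha> T ?J"
    proof (rule weighted_boundI)
      show "0 \<le> ?M * N" using M N by simp
      fix s t assume st: "0 \<le> s" "s \<le> t" "t \<le> T"
      have "holder_bound (N * exp (\<nu> * t)) \<gamma> t (\<lambda>t. x t - y t)"
        by (rule weighted_bound_imp_holder_bound[OF v]) (use \<nu> st in auto)
      from young_integral_stability[OF x y this xy st(3)]
      have "holder_bound (?M * (N * exp (\<nu> * t))) \<alpha> t ?J" .
      from holder_boundD[OF this st(1,2)]
      show "norm (?J t - ?J s) \<le> ?M * N * exp (\<nu> * t) * (t - s) powr \<alpha>" by (simp add: mult_ac)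
    qed
    then have J: "weighted_bound (2 * (?M * N) * (1 / \<nu>) powr (\<alpha> - a)) \<nu> a T ?J"
      by (rule weighted_bound_gain) (use \<nu> a in auto)
    show "weighted_bound (N / 2) \<nu> \<gamma> T (\<lambda>t. picard x0 x t - picard x0 y t)"
    proof (rule weighted_boundI)
      show "0 \<le> N / 2" using N by simp
      fix s t assume st: "0 \<le> s" "s \<le> t" "t \<le> T"
      have "holder_bound (2 * (?M * N) * (1 / \<nu>) powr (\<alpha> - a) * exp (\<nu> * t)) a t ?J"
        by (rule weighted_bound_imp_holder_bound[OF J]) (use \<nu> st in auto)
      from marchaud_holder_bound[OF this \<delta> a(3)]
      have "holder_bound (?m * (2 * (?M * N) * (1 / \<nu>) powr (\<alpha> - a) * exp (\<nu> * t))) \<gamma> t (marchaud \<delta> ?J)"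
        unfolding a(4) .
      from holder_boundD[OF this st(1,2)]
      have 1: "norm (marchaud \<delta> ?J t - marchaud \<delta> ?J s)
          \<le> ?m * (2 * ?M * (1 / \<nu>) powr (\<alpha> - a)) * (N * exp (\<nu> * t) * (t - s) powr \<gamma>)"
        by (simp add: mult_ac)
      also have "\<dots> \<le> 1 / 2 * (N * exp (\<nu> * t) * (t - s) powr \<gamma>)"
        using gain N by (intro mult_right_mono) auto
      finally have 2: "norm (marchaud \<delta> ?J t - marchaud \<delta> ?J s) \<le> N / 2 * exp (\<nu> * t) * (t - s) powr \<gamma>" by simp
      have diff: "marchaud \<delta> ?J u = picard x0 x u - picard x0 y u" if "0 \<le> u" "u \<le> T" for u
      proof -
        have "marchaud \<delta> ?J u = marchaud \<delta> (young_integral A x) u - marchaud \<delta> (young_integral A y) u"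
        proof (rule marchaud_diff)
          show "holder_bound (C + sewing_const \<theta>' * (C * R powr \<beta>) * T powr (\<beta> * \<gamma>)) \<alpha> u (young_integral A x)"
            "holder_bound (C + sewing_const \<theta>' * (C * R powr \<beta>) * T powr (\<beta> * \<gamma>)) \<alpha> u (young_integral A y)"
            using young_integral_holder_bound[OF x] young_integral_holder_bound[OF y] that
            by (auto intro: holder_bound_mono)
        qed (use that \<delta> a in auto)
        then show ?thesis by (simp add: picard_def)
      qed
      show "norm (picard x0 x t - picard x0 y t - (picard x0 x s - picard x0 y s)) \<le> N / 2 * exp (\<nu> * t) * (t - s) powr \<gamma>"
        using 2 diff[of t] diff[of s] st by simp
    qed
  qed (rule \<nu>)
qed

lemma weighted_bound_tendsto_0:
  assumes v: "\<And>n. weighted_bound (K / 2 ^ n) \<nu> \<gamma> T (v n)" and t: "t \<in> {0..T}"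
  shows "(\<lambda>n. v n t - v n 0) \<longlonglongrightarrow> 0"
proof (rule Lim_null_comparison[OF always_eventually])
  show "\<forall>n. norm (v n t - v n 0) \<le> K * exp (\<nu> * t) * (t - 0) powr \<gamma> * (1 / 2) ^ n"
    using weighted_boundD[OF v, of 0 t] t by (simp add: power_divide)
  have "(\<lambda>n. (1 / 2 :: real) ^ n) \<longlonglongrightarrow> 0" by (rule LIMSEQ_power_zero) simp
  then show "(\<lambda>n. K * exp (\<nu> * t) * (t - 0) powr \<gamma> * (1 / 2) ^ n) \<longlonglongrightarrow> 0"
    by (rule tendsto_mult_right_zero)
qed

text \<open>The radius comes from the two given paths, not from the invariant ball: the contraction
  is available on any ball. Both paths are fixed points, so applying it to the same pair halves the
  bound again and again.\<close>

lemma solution_unique: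
  assumes x: "holder \<gamma> T x" "is_solution \<delta> T A x0 x" and y: "holder \<gamma> T y" "is_solution \<delta> T A x0 y"
    and t: "t \<in> {0..T}"
  shows "y t = x t"
proof -
  obtain H K where HK: "holder_bound H \<gamma> T x" "holder_bound K \<gamma> T y"
    using x(1) y(1) holder_iff_holder_bound by metis
  define R where "R = max 1 (max H K)"
  have R: "0 < R" by (simp add: R_def)
  have hx: "holder_bound R \<gamma> T x" and hy: "holder_bound R \<gamma> T y"
    using HK by (auto intro: holder_bound_mono simp: R_def)
  have px: "\<And>t. t \<in> {0..T} \<Longrightarrow> x t = picard x0 x t" and py: "\<And>t. t \<in> {0..T} \<Longrightarrow> y t = picard x0 y t"
    using x(2) y(2) is_solution_iff[OF hx] is_solution_iff[OF hy] by auto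
  have "x 0 = x0" "y 0 = x0" using px[of 0] py[of 0] T by (auto simp: picard_0)
  then have xy: "x 0 = y 0" by simp
  obtain \<nu> where \<nu>: "0 < \<nu>" and contr: "\<And>x y x0 N. holder_bound R \<gamma> T x \<Longrightarrow> holder_bound R \<gamma> T y \<Longrightarrow> x 0 = y 0 \<Longrightarrow>
       weighted_bound N \<nu> \<gamma> T (\<lambda>t. x t - y t) \<Longrightarrow>
       weighted_bound (N / 2) \<nu> \<gamma> T (\<lambda>t. picard x0 x t - picard x0 y t)"
    by (rule ex_contraction_weight[OF R]) (rule that)
  have "weighted_bound ((R + R) / 2 ^ n) \<nu> \<gamma> T (\<lambda>t. x t - y t)" for n
  proof (induction n)
    case 0
    have "weighted_bound (R + R) \<nu> \<gamma> T (\<lambda>t. x t - y t)"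
      using \<nu> by (intro holder_bound_imp_weighted_bound holder_bound_diff hx hy) auto
    then show ?case by simp
  next
    case (Suc n)
    from contr[OF hx hy xy this, of x0]
    have "weighted_bound ((R + R) / 2 ^ n / 2) \<nu> \<gamma> T (\<lambda>t. x t - y t)"
      using weighted_bound_cong[of T "\<lambda>t. x t - y t" "\<lambda>t. picard x0 x t - picard x0 y t"] px py by simp
    then show ?case by (simp add: field_simps)
  qed
  then have "(\<lambda>n. (x t - y t) - (x 0 - y 0)) \<longlonglongrightarrow> 0" by (rule weighted_bound_tendsto_0[OF _ t])
  then show ?thesis by (simp add: LIMSEQ_const_iff xy)
qed

text \<open>The limit is taken pointwise, where completeness of the value space suffices. Continuity
  of the Picard map is known in the weighted seminorm only, so the convergence is upgraded to that
  seminorm before the limit is passed through the map.\<close>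

lemma solution_exists: "\<exists>x. holder \<gamma> T x \<and> is_solution \<delta> T A x0 x"
proof -
  obtain R where R: "0 < R" and inv: "\<And>x x0. holder_bound R \<gamma> T x \<Longrightarrow> holder_bound R \<gamma> T (picard x0 x)"
    by (rule ex_invariant_radius) (rule that)
  obtain \<nu> where \<nu>: "0 < \<nu>" and contr: "\<And>x y x0 N. holder_bound R \<gamma> T x \<Longrightarrow> holder_bound R \<gamma> T y \<Longrightarrow> x 0 = y 0 \<Longrightarrow>
       weighted_bound N \<nu> \<gamma> T (\<lambda>t. x t - y t) \<Longrightarrow>
       weighted_bound (N / 2) \<nu> \<gamma> T (\<lambda>t. picard x0 x t - picard x0 y t)"
    by (rule ex_contraction_weight[OF R]) (rule that)
  define X where "X n = (picard x0 ^^ n) (\<lambda>_. x0)" for n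
  have X_Suc: "X (Suc n) = picard x0 (X n)" for n by (simp add: X_def)
  have X_holder: "holder_bound R \<gamma> T (X n)" for n
  proof (induction n)
    case 0
    show ?case using R by (simp add: X_def holder_bound_def)
  qed (simp add: X_Suc inv)
  have X_0: "X n 0 = x0" for n by (cases n) (simp_all add: X_Suc picard_0, simp add: X_def)
  have step: "weighted_bound ((R + R) / 2 ^ n) \<nu> \<gamma> T (\<lambda>t. X (Suc n) t - X n t)" for n
  proof (induction n)
    case 0
    have "weighted_bound (R + R) \<nu> \<gamma> T (\<lambda>t. X (Suc 0) t - X 0 t)"
      using \<nu> by (intro holder_bound_imp_weighted_bound holder_bound_diff X_holder) auto
    then show ?case by simp
  next
    case (Suc n)
    have "weighted_bound ((R + R) / 2 ^ n / 2) \<nu> \<gamma> T (\<lambda>t. picard x0 (X (Suc n)) t - picard x0 (X n) t)"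
      by (rule contr[OF X_holder X_holder _ Suc]) (simp add: X_0)
    then show ?case by (simp add: X_Suc field_simps)
  qed
  \<comment> \<open>The step bounds 2 * R / 2 ^ k for k from n to n + m - 1 sum to exactly this
    value. Keeping it exact lets the induction on m close; it stays below 4 * R / 2 ^ n for all
    m.\<close>
  have tail: "weighted_bound ((4 * R) * (1 / 2 ^ n - 1 / 2 ^ (n + m))) \<nu> \<gamma> T (\<lambda>t. X (n + m) t - X n t)" for n m
  proof (induction m)
    case 0
    show ?case by (simp add: weighted_bound_def)
  next
    case (Suc m)
    from weighted_bound_add[OF step[of "n + m"] Suc]
    have "weighted_bound ((R + R) / 2 ^ (n + m) + 4 * R * (1 / 2 ^ n - 1 / 2 ^ (n + m))) \<nu> \<gamma> T (\<lambda>t. X (n + Suc m) t - X n t)"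
      by simp
    moreover have "(R + R) / 2 ^ (n + m) + 4 * R * (1 / 2 ^ n - 1 / 2 ^ (n + m)) = 4 * R * (1 / 2 ^ n - 1 / 2 ^ (n + Suc m))"
      by (simp add: field_simps)
    ultimately show ?case by simp
  qed
  have conv: "convergent (\<lambda>n. X n t)" if t: "t \<in> {0..T}" for t
  proof -
    have sum: "summable (\<lambda>n. (R + R) * exp (\<nu> * t) * (t - 0) powr \<gamma> * (1 / 2) ^ n)"
      by (intro summable_mult summable_geometric) simp
    have le: "norm (X (Suc n) t - X n t) \<le> (R + R) * exp (\<nu> * t) * (t - 0) powr \<gamma> * (1 / 2) ^ n" for n
      using weighted_boundD[OF step[of n], of 0 t] t by (simp add: X_0 power_divide)
    have "summable (\<lambda>n. X (Suc n) t - X n t)"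
      by (rule summable_comparison_test'[OF sum]) (rule le)
    then have "convergent (\<lambda>n. \<Sum>i<n. X (Suc i) t - X i t)" by (simp add: summable_iff_convergent)
    then have "convergent (\<lambda>n. X n t - X 0 t)" by (simp add: sum_lessThan_telescope[of "\<lambda>i. X i t"])
    then have "convergent (\<lambda>n. (X n t - X 0 t) + X 0 t)" by (intro convergent_add convergent_const)
    then show ?thesis by simp
  qed
  define x where "x t = lim (\<lambda>n. X n t)" for t
  have lim: "(\<lambda>n. X n t) \<longlonglongrightarrow> x t" if "t \<in> {0..T}" for t
    using conv[OF that] unfolding x_def by (simp add: convergent_LIMSEQ_iff)
  have x: "holder_bound R \<gamma> T x"
  proof (rule holder_boundI)
    fix s t assume st: "0 \<le> s" "s \<le> t" "t \<le> T"
    have "(\<lambda>n. norm (X n t - X n s)) \<longlonglongrightarrow> norm (x t - x s)"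
      using st by (intro tendsto_norm tendsto_diff lim) auto
    then show "norm (x t - x s) \<le> R * (t - s) powr \<gamma>"
      by (rule LIMSEQ_le_const2) (use holder_boundD[OF X_holder st] in auto)
  qed (use R in simp)
  have x_0: "x 0 = x0" using lim[of 0] T by (simp add: X_0 LIMSEQ_const_iff)
  have close: "weighted_bound (4 * R / 2 ^ n) \<nu> \<gamma> T (\<lambda>t. x t - X n t)" for n
  proof (rule weighted_boundI)
    fix s t assume st: "0 \<le> s" "s \<le> t" "t \<le> T"
    have "(\<lambda>m. X (m + n) u) \<longlonglongrightarrow> x u" if "u \<in> {0..T}" for u
      using lim[OF that] by (rule LIMSEQ_ignore_initial_segment)
    then have "(\<lambda>m. norm (X (m + n) t - X n t - (X (m + n) s - X n s))) \<longlonglongrightarrow> norm (x t - X n t - (x s - X n s))"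
      using st by (intro tendsto_norm tendsto_diff tendsto_const) auto
    then show "norm (x t - X n t - (x s - X n s)) \<le> 4 * R / 2 ^ n * exp (\<nu> * t) * (t - s) powr \<gamma>"
    proof (rule LIMSEQ_le_const2)
      have "norm (X (m + n) t - X n t - (X (m + n) s - X n s)) \<le> 4 * R / 2 ^ n * exp (\<nu> * t) * (t - s) powr \<gamma>" for m
      proof -
        have "norm (X (n + m) t - X n t - (X (n + m) s - X n s)) \<le> 4 * R * (1 / 2 ^ n - 1 / 2 ^ (n + m)) * exp (\<nu> * t) * (t - s) powr \<gamma>"
          by (rule weighted_boundD[OF tail st])
        also have "\<dots> \<le> 4 * R * (1 / 2 ^ n) * exp (\<nu> * t) * (t - s) powr \<gamma>"
          using R by (intro mult_right_mono mult_left_mono) auto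
        finally show ?thesis by (simp add: add.commute)
      qed
      then show "\<exists>N. \<forall>m\<ge>N. norm (X (m + n) t - X n t - (X (m + n) s - X n s)) \<le> 4 * R / 2 ^ n * exp (\<nu> * t) * (t - s) powr \<gamma>" by auto
    qed
  qed (use R in simp)
  have "x t = picard x0 x t" if t: "t \<in> {0..T}" for t
  proof -
    \<comment> \<open>The pair x, \<open>X n\<close> is admissible because the limit lies in the
      same ball and starts at x0; the contraction shows that \<open>X (Suc n)\<close> converges to
      the image of x.\<close>
    have "weighted_bound (2 * R / 2 ^ n) \<nu> \<gamma> T (\<lambda>t. picard x0 x t - picard x0 (X n) t)" for n
      using contr[OF x X_holder[of n] _ close[of n], of x0] by (simp add: x_0 X_0)
    from weighted_bound_tendsto_0[OF this t]
    have "(\<lambda>n. picard x0 x t - X (Suc n) t) \<longlonglongrightarrow> 0" by (simp add: picard_0 X_Suc)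
    then have "(\<lambda>n. picard x0 x t - (picard x0 x t - X (Suc n) t)) \<longlonglongrightarrow> picard x0 x t - 0"
      by (intro tendsto_diff tendsto_const)
    then have "(\<lambda>n. X (Suc n) t) \<longlonglongrightarrow> picard x0 x t" by simp
    moreover have "(\<lambda>n. X (Suc n) t) \<longlonglongrightarrow> x t" using lim[OF t] by (rule LIMSEQ_Suc)
    ultimately show ?thesis by (rule LIMSEQ_unique[rotated])
  qed
  then have "is_solution \<delta> T A x0 x" using is_solution_iff[OF x] by blast
  then show ?thesis using x holder_iff_holder_bound by blast
qed

end

text \<open>Equality is claimed on [0, T] because a path is a total function, and Hoelder continuity
  and the equation constrain it on that interval only.\<close>

theorem mainTheorem16:
  fixes A :: "real \<Rightarrow> 'a::euclidean_space \<Rightarrow> 'a" and x0 :: 'a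
    and T \<delta> \<alpha> \<beta> \<gamma> :: real
  assumes "T > 0"
    and "0 < \<delta>" "\<delta> < 1"
    and "0 < \<alpha>" "\<alpha> < 1" "0 < \<beta>" "\<beta> < 1"
    and "\<alpha> + \<delta> - 1 > (1 - \<alpha>) / \<beta>"
    and "field_class \<alpha> \<beta> T A"
    and "\<alpha> + \<delta> - 1 > \<gamma>" "\<gamma> > (1 - \<alpha>) / \<beta>"
  shows "\<exists>x. holder \<gamma> T x \<and> is_solution \<delta> T A x0 x \<and>
           (\<forall>y. holder \<gamma> T y \<and> is_solution \<delta> T A x0 y \<longrightarrow> (\<forall>t\<in>{0..T}. y t = x t))"
proof -
  have "0 < (1 - \<alpha>) / \<beta>" using assms by simp
  then have \<gamma>: "0 < \<gamma>" using assms by linarith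
  have \<theta>: "1 < \<alpha> + \<beta> * \<gamma>" using assms by (simp add: field_simps)
  obtain C where C: "0 \<le> C"
    "\<And>s t x. 0 \<le> s \<Longrightarrow> s \<le> t \<Longrightarrow> t \<le> T \<Longrightarrow> norm (increment A s t x) \<le> C * (t - s) powr \<alpha>"
    "\<And>s t x y. 0 \<le> s \<Longrightarrow> s \<le> t \<Longrightarrow> t \<le> T \<Longrightarrow>
       norm (increment A s t x - increment A s t y) \<le> C * (t - s) powr \<alpha> * norm (x - y) powr \<beta>"
    "\<And>s t x y. 0 \<le> s \<Longrightarrow> s \<le> t \<Longrightarrow> t \<le> T \<Longrightarrow>
       norm (increment A s t x - increment A s t y) \<le> C * (t - s) powr \<alpha> * norm (x - y)"
    "\<And>s t a b p q. 0 \<le> s \<Longrightarrow> s \<le> t \<Longrightarrow> t \<le> T \<Longrightarrow>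
       norm (increment A s t a - increment A s t b - (increment A s t p - increment A s t q))
         \<le> C * (t - s) powr \<alpha> * (norm ((a - p) - (b - q)) + norm (a - b) powr \<beta> * norm (b - q))"
    by (rule field_class_bounds[OF assms(9)]) (rule that)
  interpret fractional_yde A \<delta> \<alpha> \<beta> \<gamma> T C
    by (rule fractional_yde.intro[OF assms(1-7) \<gamma> assms(10) \<theta> C])
  show ?thesis using solution_exists solution_unique by blast
qed

end
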